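(* Let $F:\Sigma\to\Sigma$, $F(x,z)=(f(x),G(x,z))$, be a skew product satisfying all the assumptions on the base map $f$ and on the fiber map $G$ listed in the context, and let $\mu_0$ be the unique $F$-invariant probability measure in $S^\infty$. Let $F_*=P+N$ be a decomposition of $F_*:S^\infty\to S^\infty$ into linear operators with $P^2=P$, $\dim P(S^\infty)=1$, $PN=NP=0$, and let $0<\xi<1$, $K_0>0$ be constants with $\|N^n\mu\|_{S^\infty}\le K_0\xi^n\|\mu\|_{S^\infty}$ for all $\mu\in S^\infty$, $n\ge1$. Then for every $\zeta$-Hölder function $g:\Sigma\to\mathbb R$ and every $h\in\Theta_{\mu_0}$, $$\left|\int (g\circ F^n)\,h\,d\mu_0-\int g\,d\mu_0\int h\,d\mu_0\right|\le \|h\mu_0\|_{S^\infty}\,K_0\,|g|_\zeta\,\xi^n\qquad\text{for all } n\ge1,$$ where $|g|_\zeta=|g|_\infty+H_\zeta(g)$.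
   Context: Base map. Fix $0<\zeta<1$. $M$ is a compact connected Riemannian manifold with Riemannian distance $d_1$ and $\operatorname{diam}(M)=1$. For a real function $h$ on a metric space $(X,d)$ put $H_\zeta(h)=\sup_{x\neq y}|h(x)-h(y)|/d(x,y)^\zeta$, and $|h|_\zeta=H_\zeta(h)+|h|_\infty$; $H_\zeta$ denotes the set of $h:M\to\mathbb R$ with $H_\zeta(h)<\infty$. The map $f:M\to M$ is a local diffeomorphism and there is a continuous $\ell:M\to\mathbb R$ such that every $x\in M$ has a neighbourhood $U_x$ on which $f_x:=f|_{U_x}:U_x\to f(U_x)$ is invertible with $d_1(f_x^{-1}(y),f_x^{-1}(z))\le \ell(x)\,d_1(y,z)$ for $y,z\in f(U_x)$; $\deg(f)=\#f^{-1}(x)$ (constant in $x$). There are an open set $\mathcal A\subset M$ and constants $\sigma>1$, $L\ge 1$, $\epsilon_\rho>0$ and an integer $q<\deg(f)$ with: (f1) $\ell(x)\le L$ for $x\in\mathcal A$ and $\ell(x)<\sigma^{-1}$ for $x\notin\mathcal A$; (f2) there is a finite covering of $M$ by open domains of injectivity of $f$ such that $\mathcal A$ can be covered by $q$ of them; (f3) $\sup\log\rho-\inf\log\rho<\epsilon_\rho$ and $H_\zeta(\rho)<\epsilon_\rho\inf\rho$; and $e^{\epsilon_\rho}\cdot\frac{(\deg(f)-q)\sigma^{-\zeta}+qL^\zeta[1+(L-1)^\zeta]}{\deg(f)}<1$. Here $m_1$ is the $f$-invariant Borel probability of maximal entropy, absolutely continuous with respect to a conformal measure (known to exist for such $f$),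 and $\rho=1/|\det f'|$, where $|\det f'|$ is the Jacobian of $f$ with respect to $m_1$. The Perron-Frobenius operator with respect to $m_1$ is $P_f(\varphi)(x)=\sum_{i=1}^{\deg(f)}\varphi(x_i)\rho(x_i)$, where $x_1,\dots,x_{\deg(f)}$ are the preimages of $x$; since $m_1$ is invariant, $P_f1=1$. It is known that there are $0<r<1$, $D>0$ with $|P_f^n\varphi|_\zeta\le Dr^n|\varphi|_\zeta$ for all $n\ge1$ and all $\varphi\in H_\zeta$ with $\int\varphi\,dm_1=0$. Fiber map. $(K,d_2)$ is a compact metric space, $\Sigma=M\times K$ with metric $d_1+d_2$, $G:\Sigma\to K$ is measurable, and (G1): there is $0<\alpha<1$ such that for $m_1$-a.e. $x\in M$, $d_2(G(x,z_1),G(x,z_2))\le\alpha\, d_2(z_1,z_2)$ for all $z_1,z_2\in K$. Measures. $\pi_x(x,y)=x$, $\pi_y(x,y)=y$. $\mathcal{AB}$ is the set of signed Borel measures $\mu$ on $\Sigma$, with Jordan decomposition $\mu=\mu^+-\mu^-$, such that $\pi_{x*}\mu^\pm\ll m_1$. A positive $\mu\in\mathcal{AB}$ has a Rokhlin disintegration $(\{\mu_\gamma\}_{\gamma\in M},\phi_xm_1)$ along the leaves $\{\gamma\}\times K$, with $\mu_\gamma$ a probability on $\{\gamma\}\times K$ and $\phi_x=d(\pi_{x*}\mu)/dm_1$; the restriction is the measure on $K$ given by $\mu|_\gamma=\pi_{y*}(\phi_x(\gamma)\mu_\gamma)$. For signed $\mu\in\mathcal{AB}$, $\mu|_\gamma=\mu^+|_\gamma-\mu^-|_\gamma$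 and $\phi_x=\phi_x^+-\phi_x^-$, where $\phi_x^\pm$ are the marginal densities of $\mu^\pm$. For a signed measure $\nu$ on $K$, $\|\nu\|_W=\sup\{|\int g\,d\nu|: |g|_\infty\le1,\ H_\zeta(g)\le1\}$, with $g:K\to\mathbb R$. $\mathcal L^\infty=\{\mu\in\mathcal{AB}:\|\mu\|_\infty<\infty\}$ with $\|\mu\|_\infty=\operatorname{ess\,sup}_\gamma\|\mu|_\gamma\|_W$ (with respect to $m_1$), and $S^\infty=\{\mu\in\mathcal L^\infty:\phi_x\in H_\zeta\}$ (i.e. $\phi_x$ has a version in $H_\zeta$) with norm $\|\mu\|_{S^\infty}=|\phi_x|_\zeta+\|\mu\|_\infty$. The transfer operator is the pushforward $(F_*\mu)(E)=\mu(F^{-1}(E))$. There is exactly one $F$-invariant probability $\mu_0$ in $S^\infty$, and a decomposition $F_*=P+N$ as in the claim exists. $\Theta_{\mu_0}$ is the set of ($\mu_0$-integrable) functions $h:\Sigma\to\mathbb R$ such that the measure $h\mu_0$, $(h\mu_0)(E)=\int_Eh\,d\mu_0$, belongs to $S^\infty$. *)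

theory Defs
  imports "HOL-Probability.Probability"
begin

section \<open>Hoelder functions\<close>

text \<open>The distance is an argument because the product type carries the Euclidean product
  metric, whereas the product space below uses the sum metric (which has the same topology).
  Suprema are taken in \<^typ>\<open>ennreal\<close>, so that an unbounded supremum is infinite.\<close>

definition sum_dist :: "'a::metric_space \<times> 'b::metric_space \<Rightarrow> 'a \<times> 'b \<Rightarrow> real" where
  "sum_dist p q = dist (fst p) (fst q) + dist (snd p) (snd q)"

definition holder_const :: "('a \<Rightarrow> 'a \<Rightarrow> real) \<Rightarrow> real \<Rightarrow> ('a \<Rightarrow> real) \<Rightarrow> ennreal" where
  "holder_const d \<zeta> h = (SUP (x, y)\<in>{(x, y). x \<noteq> y}. ennreal (\<bar>h x - h y\<bar> / d x y powr \<zeta>))"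

definition sup_norm :: "('a \<Rightarrow> real) \<Rightarrow> ennreal" where
  "sup_norm h = (SUP x. ennreal \<bar>h x\<bar>)"

definition holder_norm :: "('a \<Rightarrow> 'a \<Rightarrow> real) \<Rightarrow> real \<Rightarrow> ('a \<Rightarrow> real) \<Rightarrow> ennreal" where
  "holder_norm d \<zeta> h = holder_const d \<zeta> h + sup_norm h"

definition holder_functions :: "('a \<Rightarrow> 'a \<Rightarrow> real) \<Rightarrow> real \<Rightarrow> ('a \<Rightarrow> real) set" where
  "holder_functions d \<zeta> = {h. holder_const d \<zeta> h < \<infinity>}"

section \<open>Riemannian manifolds\<close>

primrec Ck_on :: "nat \<Rightarrow> 'a::euclidean_space set \<Rightarrow> ('a \<Rightarrow> 'b::real_normed_vector) \<Rightarrow> bool" where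
  "Ck_on 0 S f \<longleftrightarrow> continuous_on S f"
| "Ck_on (Suc k) S f \<longleftrightarrow>
     f differentiable_on S \<and> (\<forall>v. Ck_on k S (\<lambda>x. frechet_derivative f (at x) v))"

definition smooth_on :: "'a::euclidean_space set \<Rightarrow> ('a \<Rightarrow> 'b::real_normed_vector) \<Rightarrow> bool" where
  "smooth_on S f \<longleftrightarrow> (\<forall>k. Ck_on k S f)"

text \<open>A chart is a pair of its domain and its coordinate map.\<close>

type_synonym ('m, 'e) chart = "'m set \<times> ('m \<Rightarrow> 'e)"

definition chart_inv :: "('m, 'e) chart \<Rightarrow> 'e \<Rightarrow> 'm" where
  "chart_inv c = inv_into (fst c) (snd c)"

definition smooth_atlas :: "('m::topological_space, 'e::euclidean_space) chart set \<Rightarrow> bool" where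
  "smooth_atlas \<A> \<longleftrightarrow>
     (\<Union>c\<in>\<A>. fst c) = UNIV \<and>
     (\<forall>c\<in>\<A>. open (fst c) \<and> open (snd c ` fst c) \<and>
        homeomorphism (fst c) (snd c ` fst c) (snd c) (chart_inv c)) \<and>
     (\<forall>c\<in>\<A>. \<forall>c'\<in>\<A>. smooth_on (snd c ` (fst c \<inter> fst c')) (snd c' \<circ> chart_inv c))"

text \<open>\<open>G c p v w\<close> is the inner product, at the point \<open>p\<close>, of the tangent vectors whose
  coordinates in the chart \<open>c\<close> are \<open>v\<close> and \<open>w\<close>.\<close>

type_synonym ('m, 'e) metric_tensor = "('m, 'e) chart \<Rightarrow> 'm \<Rightarrow> 'e \<Rightarrow> 'e \<Rightarrow> real"

definition riemannian_metric ::
  "('m::topological_space, 'e::euclidean_space) chart set \<Rightarrow> ('m, 'e) metric_tensor \<Rightarrow> bool" where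
  "riemannian_metric \<A> G \<longleftrightarrow>
     (\<forall>c\<in>\<A>. \<forall>p\<in>fst c. bilinear (G c p) \<and> (\<forall>v w. G c p v w = G c p w v) \<and>
        (\<forall>v. v \<noteq> 0 \<longrightarrow> 0 < G c p v v)) \<and>
     (\<forall>c\<in>\<A>. \<forall>v w. smooth_on (snd c ` fst c) (\<lambda>x. G c (chart_inv c x) v w)) \<and>
     (\<forall>c\<in>\<A>. \<forall>c'\<in>\<A>. \<forall>p\<in>fst c \<inter> fst c'. \<forall>v w.
        let D = frechet_derivative (snd c' \<circ> chart_inv c) (at (snd c p))
        in G c p v w = G c' p (D v) (D w))"

text \<open>As for the library's piecewise C1 functions, no one-sided derivatives are required at the
  exceptional points. The length of such a curve can therefore be infinite, and it is a
  nonnegative integral.\<close>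

definition piecewise_C1_curve ::
  "('m::topological_space, 'e::euclidean_space) chart set \<Rightarrow> (real \<Rightarrow> 'm) \<Rightarrow> bool" where
  "piecewise_C1_curve \<A> \<gamma> \<longleftrightarrow> continuous_on {0..1} \<gamma> \<and>
     (\<exists>S. finite S \<and> (\<forall>c\<in>\<A>. (snd c \<circ> \<gamma>) C1_differentiable_on ({0..1} \<inter> \<gamma> -` fst c - S)))"

text \<open>The speed does not depend on the chart, by the transformation law of the metric tensor.\<close>

definition curve_speed ::
  "('m, 'e::euclidean_space) chart set \<Rightarrow> ('m, 'e) metric_tensor \<Rightarrow> (real \<Rightarrow> 'm) \<Rightarrow> real \<Rightarrow> real" where
  "curve_speed \<A> G \<gamma> t =
     (let c = (SOME c. c \<in> \<A> \<and> \<gamma> t \<in> fst c); v = vector_derivative (snd c \<circ> \<gamma>) (at t)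
      in sqrt (G c (\<gamma> t) v v))"

definition curve_length ::
  "('m, 'e::euclidean_space) chart set \<Rightarrow> ('m, 'e) metric_tensor \<Rightarrow> (real \<Rightarrow> 'm) \<Rightarrow> ennreal" where
  "curve_length \<A> G \<gamma> = (\<integral>\<^sup>+t\<in>{0..1}. ennreal (curve_speed \<A> G \<gamma> t) \<partial>lborel)"

definition riemannian_distance ::
  "('m::topological_space, 'e::euclidean_space) chart set \<Rightarrow> ('m, 'e) metric_tensor \<Rightarrow>
    'm \<Rightarrow> 'm \<Rightarrow> ennreal" where
  "riemannian_distance \<A> G x y =
     (INF \<gamma>\<in>{\<gamma>. piecewise_C1_curve \<A> \<gamma> \<and> \<gamma> 0 = x \<and> \<gamma> 1 = y}. curve_length \<A> G \<gamma>)"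

text \<open>The whole type is a Riemannian manifold, and \<^const>\<open>dist\<close> is its Riemannian distance.\<close>

definition riemannian_manifold ::
  "('m::metric_space, 'e::euclidean_space) chart set \<Rightarrow> ('m, 'e) metric_tensor \<Rightarrow> bool" where
  "riemannian_manifold \<A> G \<longleftrightarrow> smooth_atlas \<A> \<and> riemannian_metric \<A> G \<and>
     (\<forall>x y. ennreal (dist x y) = riemannian_distance \<A> G x y)"

definition C1_map_on ::
  "('m::topological_space, 'e::euclidean_space) chart set \<Rightarrow> 'm set \<Rightarrow> ('m \<Rightarrow> 'm) \<Rightarrow> bool" where
  "C1_map_on \<A> U f \<longleftrightarrow> continuous_on U f \<and>
     (\<forall>c\<in>\<A>. \<forall>c'\<in>\<A>. Ck_on 1 (snd c ` (fst c \<inter> U \<inter> f -` fst c')) (snd c' \<circ> f \<circ> chart_inv c))"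

definition local_diffeomorphism ::
  "('m::topological_space, 'e::euclidean_space) chart set \<Rightarrow> ('m \<Rightarrow> 'm) \<Rightarrow> bool" where
  "local_diffeomorphism \<A> f \<longleftrightarrow>
     (\<forall>x. \<exists>U. open U \<and> x \<in> U \<and> open (f ` U) \<and> inj_on f U \<and>
        C1_map_on \<A> U f \<and> C1_map_on \<A> (f ` U) (inv_into U f))"

definition map_degree :: "('m \<Rightarrow> 'm) \<Rightarrow> nat" where
  "map_degree f = (THE n. \<forall>x. finite (f -` {x}) \<and> card (f -` {x}) = n)"

section \<open>Invariant measures, entropy, Jacobians\<close>

definition borel_prob :: "'a::topological_space measure \<Rightarrow> bool" where
  "borel_prob \<mu> \<longleftrightarrow> prob_space \<mu> \<and> sets \<mu> = sets borel"

definition invariant_prob :: "('a::topological_space \<Rightarrow> 'a) \<Rightarrow> 'a measure \<Rightarrow> bool" where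
  "invariant_prob f \<mu> \<longleftrightarrow> borel_prob \<mu> \<and> distr \<mu> borel f = \<mu>"

definition borel_partition :: "'a::topological_space set set \<Rightarrow> bool" where
  "borel_partition Q \<longleftrightarrow> finite Q \<and> Q \<subseteq> sets borel \<and> partition_on UNIV Q"

definition iterated_join :: "('a \<Rightarrow> 'a) \<Rightarrow> 'a set set \<Rightarrow> nat \<Rightarrow> 'a set set" where
  "iterated_join f Q n = {\<Inter>i<n. (f ^^ i) -` A i |A. \<forall>i<n. A i \<in> Q} - {{}}"

definition partition_entropy :: "'a measure \<Rightarrow> 'a set set \<Rightarrow> real" where
  "partition_entropy \<mu> Q = - (\<Sum>A\<in>Q. measure \<mu> A * ln (measure \<mu> A))"

definition ks_entropy :: "('a::topological_space \<Rightarrow> 'a) \<Rightarrow> 'a measure \<Rightarrow> ereal" where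
  "ks_entropy f \<mu> = (SUP Q\<in>{Q. borel_partition Q}.
     ereal (lim (\<lambda>n. partition_entropy \<mu> (iterated_join f Q n) / real n)))"

definition max_entropy_prob :: "('a::topological_space \<Rightarrow> 'a) \<Rightarrow> 'a measure \<Rightarrow> bool" where
  "max_entropy_prob f \<mu> \<longleftrightarrow> invariant_prob f \<mu> \<and>
     (\<forall>\<nu>. invariant_prob f \<nu> \<longrightarrow> ks_entropy f \<nu> \<le> ks_entropy f \<mu>)"

definition is_jacobian ::
  "('a::topological_space \<Rightarrow> 'a) \<Rightarrow> 'a measure \<Rightarrow> ('a \<Rightarrow> real) \<Rightarrow> bool" where
  "is_jacobian f \<mu> J \<longleftrightarrow> J \<in> borel_measurable borel \<and> (\<forall>x. 0 < J x) \<and>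
     (\<forall>A\<in>sets borel. inj_on f A \<longrightarrow> emeasure \<mu> (f ` A) = (\<integral>\<^sup>+x\<in>A. ennreal (J x) \<partial>\<mu>))"

text \<open>Conformality is with respect to some continuous potential \<open>\<phi>\<close> and eigenvalue \<open>c\<close>.\<close>

definition conformal_prob :: "('a::topological_space \<Rightarrow> 'a) \<Rightarrow> 'a measure \<Rightarrow> bool" where
  "conformal_prob f \<nu> \<longleftrightarrow> borel_prob \<nu> \<and>
     (\<exists>c \<phi>. 0 < c \<and> continuous_on UNIV \<phi> \<and> is_jacobian f \<nu> (\<lambda>x. c * exp (- \<phi> x)))"

section \<open>Signed Borel measures\<close>

typedef (overloaded) 'a::topological_space signed_measure =
  "{\<mu> :: 'a set \<Rightarrow> real. (\<forall>E. E \<notin> sets borel \<longrightarrow> \<mu> E = 0) \<and>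
     (\<forall>A::nat \<Rightarrow> 'a set. range A \<subseteq> sets borel \<longrightarrow> disjoint_family A \<longrightarrow>
        (\<lambda>n. \<mu> (A n)) sums \<mu> (\<Union>n. A n))}"
  morphisms sm_apply Abs_signed_measure
  by (rule exI[of _ "\<lambda>_. 0"]) auto

setup_lifting type_definition_signed_measure

instantiation signed_measure :: (topological_space) real_vector
begin

lift_definition zero_signed_measure :: "'a signed_measure" is "\<lambda>_. 0"
  by auto

lift_definition plus_signed_measure ::
  "'a signed_measure \<Rightarrow> 'a signed_measure \<Rightarrow> 'a signed_measure" is "\<lambda>\<mu> \<nu> E. \<mu> E + \<nu> E"
  by (auto intro: sums_add)

lift_definition minus_signed_measure ::
  "'a signed_measure \<Rightarrow> 'a signed_measure \<Rightarrow> 'a signed_measure" is "\<lambda>\<mu> \<nu> E. \<mu> E - \<nu> E"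
  by (auto intro: sums_diff)

lift_definition uminus_signed_measure ::
  "'a signed_measure \<Rightarrow> 'a signed_measure" is "\<lambda>\<mu> E. - \<mu> E"
  by (auto intro: sums_minus)

lift_definition scaleR_signed_measure ::
  "real \<Rightarrow> 'a signed_measure \<Rightarrow> 'a signed_measure" is "\<lambda>c \<mu> E. c * \<mu> E"
  by (auto intro: sums_mult)

instance
  by standard (transfer; auto simp: algebra_simps)+

end

text \<open>The junk value in the next two definitions is only reached for a measure that is infinite or
  not a Borel measure, and for a map that is not Borel measurable, respectively.\<close>

lift_definition signed_of :: "'a::topological_space measure \<Rightarrow> 'a signed_measure" is
  "\<lambda>\<mu> E. if finite_measure \<mu> \<and> sets \<mu> = sets borel then measure \<mu> E else 0"
proof (intro conjI allI impI)
  fix \<mu> :: "'a measure" and A :: "nat \<Rightarrow> 'a set"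
  assume A: "range A \<subseteq> sets borel" "disjoint_family A"
  show "(\<lambda>n. if finite_measure \<mu> \<and> sets \<mu> = sets borel then measure \<mu> (A n) else 0) sums
    (if finite_measure \<mu> \<and> sets \<mu> = sets borel then measure \<mu> (\<Union>n. A n) else 0)"
  proof (cases "finite_measure \<mu> \<and> sets \<mu> = sets borel")
    case True
    then show ?thesis
      using A finite_measure.finite_measure_UNION[of \<mu> A] by simp
  next
    case False
    then show ?thesis by (simp only: if_False sums_zero)
  qed
next
  fix \<mu> :: "'a measure" and E :: "'a set"
  assume "E \<notin> sets borel"
  then show "(if finite_measure \<mu> \<and> sets \<mu> = sets borel then measure \<mu> E else 0) = 0"
    by (simp add: measure_notin_sets)
qed

lift_definition push_forward ::
  "('a::topological_space \<Rightarrow> 'b::topological_space) \<Rightarrow> 'a signed_measure \<Rightarrow> 'b signed_measure" is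
  "\<lambda>F \<mu> E. if F \<in> borel_measurable borel \<and> E \<in> sets borel then \<mu> (F -` E) else 0"
proof -
  fix F :: "'a \<Rightarrow> 'b" and \<mu> :: "'a set \<Rightarrow> real"
  assume \<mu>: "(\<forall>E. E \<notin> sets borel \<longrightarrow> \<mu> E = 0) \<and>
     (\<forall>A::nat \<Rightarrow> 'a set. range A \<subseteq> sets borel \<longrightarrow> disjoint_family A \<longrightarrow>
        (\<lambda>n. \<mu> (A n)) sums \<mu> (\<Union>n. A n))"
  have "(\<lambda>n. \<mu> (F -` A n)) sums \<mu> (F -` (\<Union>n. A n))"
    if "F \<in> borel_measurable borel" "range A \<subseteq> sets borel" "disjoint_family A"
    for A :: "nat \<Rightarrow> 'b set"
  proof -
    have "range (\<lambda>n. F -` A n) \<subseteq> sets borel"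
      using that(1,2) measurable_sets[OF that(1)] by (auto simp: image_subset_iff)
    moreover have "disjoint_family (\<lambda>n. F -` A n)"
      using that(3) by (auto simp: disjoint_family_on_def)
    ultimately show ?thesis
      using \<mu> by (simp add: vimage_UN)
  qed
  then show "(\<forall>E. E \<notin> sets borel \<longrightarrow>
      (if F \<in> borel_measurable borel \<and> E \<in> sets borel then \<mu> (F -` E) else 0) = 0) \<and>
    (\<forall>A::nat \<Rightarrow> 'b set. range A \<subseteq> sets borel \<longrightarrow> disjoint_family A \<longrightarrow>
      (\<lambda>n. if F \<in> borel_measurable borel \<and> A n \<in> sets borel then \<mu> (F -` A n) else 0) sums
      (if F \<in> borel_measurable borel \<and> (\<Union>n. A n) \<in> sets borel then \<mu> (F -` (\<Union>n. A n)) else 0))"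
    by (auto simp: image_subset_iff)
qed

text \<open>The signed measure \<open>h \<mu>\<close>, for a Borel probability \<open>\<mu>\<close> and an integrable \<open>h\<close>.\<close>

definition weighted :: "('a::topological_space \<Rightarrow> real) \<Rightarrow> 'a measure \<Rightarrow> 'a signed_measure" where
  "weighted h \<mu> = Abs_signed_measure (\<lambda>E. if E \<in> sets borel then (LINT x:E|\<mu>. h x) else 0)"

definition jordan_decomposition ::
  "'a::topological_space signed_measure \<Rightarrow> 'a measure \<Rightarrow> 'a measure \<Rightarrow> bool" where
  "jordan_decomposition \<mu> p n \<longleftrightarrow>
     finite_measure p \<and> sets p = sets borel \<and> finite_measure n \<and> sets n = sets borel \<and>
     (\<exists>A\<in>sets borel. emeasure p (- A) = 0 \<and> emeasure n A = 0) \<and>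
     \<mu> = signed_of p - signed_of n"

definition pos_part :: "'a::topological_space signed_measure \<Rightarrow> 'a measure" where
  "pos_part \<mu> = (THE p. \<exists>n. jordan_decomposition \<mu> p n)"

definition neg_part :: "'a::topological_space signed_measure \<Rightarrow> 'a measure" where
  "neg_part \<mu> = (THE n. \<exists>p. jordan_decomposition \<mu> p n)"

definition signed_integral :: "'a::topological_space signed_measure \<Rightarrow> ('a \<Rightarrow> real) \<Rightarrow> real" where
  "signed_integral \<mu> g = (LINT x|pos_part \<mu>. g x) - (LINT x|neg_part \<mu>. g x)"

definition W_norm :: "real \<Rightarrow> 'k::metric_space signed_measure \<Rightarrow> ennreal" where
  "W_norm \<zeta> \<nu> =
     (SUP g\<in>{g. sup_norm g \<le> 1 \<and> holder_const dist \<zeta> g \<le> 1}. ennreal \<bar>signed_integral \<nu> g\<bar>)"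

section \<open>Disintegration along the vertical leaves\<close>

definition marginal_density ::
  "'m::topological_space measure \<Rightarrow> ('m \<times> 'k::topological_space) measure \<Rightarrow> 'm \<Rightarrow> real" where
  "marginal_density m \<mu> \<gamma> = enn2real (RN_deriv m (distr \<mu> borel fst) \<gamma>)"

definition disintegration ::
  "'m::topological_space measure \<Rightarrow> ('m \<times> 'k::topological_space) measure \<Rightarrow>
    ('m \<Rightarrow> ('m \<times> 'k) measure) \<Rightarrow> bool" where
  "disintegration m \<mu> \<kappa> \<longleftrightarrow>
     (\<forall>\<gamma>. borel_prob (\<kappa> \<gamma>) \<and> emeasure (\<kappa> \<gamma>) ({\<gamma>} \<times> UNIV) = 1) \<and>
     (\<forall>E\<in>sets borel. (\<lambda>\<gamma>. emeasure (\<kappa> \<gamma>) E) \<in> borel_measurable m \<and>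
        emeasure \<mu> E =
          (\<integral>\<^sup>+\<gamma>. emeasure (\<kappa> \<gamma>) E \<partial>density m (\<lambda>\<gamma>. ennreal (marginal_density m \<mu> \<gamma>))))"

definition leaf_measure ::
  "'m::topological_space measure \<Rightarrow> ('m \<times> 'k::topological_space) measure \<Rightarrow>
    ('m \<Rightarrow> ('m \<times> 'k) measure) \<Rightarrow> 'm \<Rightarrow> 'k measure" where
  "leaf_measure m \<mu> \<kappa> \<gamma> =
     distr (scale_measure (ennreal (marginal_density m \<mu> \<gamma>)) (\<kappa> \<gamma>)) borel snd"

text \<open>The restriction of \<open>\<mu>\<close> to the leaf over \<open>\<gamma>\<close>, where \<open>\<kappa>\<close> and \<open>\<kappa>'\<close> are disintegrations of the
  positive and of the negative part.\<close>

definition leaf_restriction ::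
  "'m::topological_space measure \<Rightarrow> ('m \<times> 'k::topological_space) signed_measure \<Rightarrow>
    ('m \<Rightarrow> ('m \<times> 'k) measure) \<Rightarrow> ('m \<Rightarrow> ('m \<times> 'k) measure) \<Rightarrow> 'm \<Rightarrow> 'k signed_measure" where
  "leaf_restriction m \<mu> \<kappa> \<kappa>' \<gamma> =
     signed_of (leaf_measure m (pos_part \<mu>) \<kappa> \<gamma>) - signed_of (leaf_measure m (neg_part \<mu>) \<kappa>' \<gamma>)"

definition AB :: "'m::topological_space measure \<Rightarrow> ('m \<times> 'k::topological_space) signed_measure set"
  where
  "AB m = {\<mu>. absolutely_continuous m (distr (pos_part \<mu>) borel fst) \<and>
              absolutely_continuous m (distr (neg_part \<mu>) borel fst)}"

text \<open>Disintegrations and densities are determined only up to null sets. The two norms below are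
  infima over all choices. By Rokhlin's theorem, on compact metric spaces every \<open>\<mu>\<close> in \<^const>\<open>AB\<close> has
  disintegrations, and they all give the same essential supremum.\<close>

definition Linf_norm ::
  "real \<Rightarrow> 'm::topological_space measure \<Rightarrow> ('m \<times> 'k::metric_space) signed_measure \<Rightarrow> ennreal" where
  "Linf_norm \<zeta> m \<mu> =
     (INF (\<kappa>, \<kappa>')\<in>{(\<kappa>, \<kappa>'). disintegration m (pos_part \<mu>) \<kappa> \<and> disintegration m (neg_part \<mu>) \<kappa>'}.
        esssup m (\<lambda>\<gamma>. W_norm \<zeta> (leaf_restriction m \<mu> \<kappa> \<kappa>' \<gamma>)))"

definition Linf ::
  "real \<Rightarrow> 'm::topological_space measure \<Rightarrow> ('m \<times> 'k::metric_space) signed_measure set" where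
  "Linf \<zeta> m = {\<mu> \<in> AB m. Linf_norm \<zeta> m \<mu> < \<infinity>}"

definition signed_marginal_density ::
  "'m::topological_space measure \<Rightarrow> ('m \<times> 'k::topological_space) signed_measure \<Rightarrow> 'm \<Rightarrow> real" where
  "signed_marginal_density m \<mu> \<gamma> =
     marginal_density m (pos_part \<mu>) \<gamma> - marginal_density m (neg_part \<mu>) \<gamma>"

definition holder_versions ::
  "real \<Rightarrow> 'm::metric_space measure \<Rightarrow> ('m \<times> 'k::topological_space) signed_measure \<Rightarrow>
    ('m \<Rightarrow> real) set" where
  "holder_versions \<zeta> m \<mu> =
     {\<phi> \<in> holder_functions dist \<zeta>. AE \<gamma> in m. \<phi> \<gamma> = signed_marginal_density m \<mu> \<gamma>}"

definition Sinf ::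
  "real \<Rightarrow> 'm::metric_space measure \<Rightarrow> ('m \<times> 'k::metric_space) signed_measure set" where
  "Sinf \<zeta> m = {\<mu> \<in> Linf \<zeta> m. holder_versions \<zeta> m \<mu> \<noteq> {}}"

definition Sinf_norm ::
  "real \<Rightarrow> 'm::metric_space measure \<Rightarrow> ('m \<times> 'k::metric_space) signed_measure \<Rightarrow> ennreal" where
  "Sinf_norm \<zeta> m \<mu> = (INF \<phi>\<in>holder_versions \<zeta> m \<mu>. holder_norm dist \<zeta> \<phi>) + Linf_norm \<zeta> m \<mu>"

definition linear_operator_on :: "'v::real_vector set \<Rightarrow> ('v \<Rightarrow> 'v) \<Rightarrow> bool" where
  "linear_operator_on S T \<longleftrightarrow> T ` S \<subseteq> S \<and>
     (\<forall>u\<in>S. \<forall>v\<in>S. T (u + v) = T u + T v) \<and> (\<forall>c. \<forall>u\<in>S. T (c *\<^sub>R u) = c *\<^sub>R T u)"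

definition skew_product :: "('m \<Rightarrow> 'm) \<Rightarrow> ('m \<times> 'k \<Rightarrow> 'k) \<Rightarrow> 'm \<times> 'k \<Rightarrow> 'm \<times> 'k" where
  "skew_product f G = (\<lambda>(x, z). (f x, G (x, z)))"

definition Theta ::
  "real \<Rightarrow> 'm::metric_space measure \<Rightarrow> ('m \<times> 'k::metric_space) measure \<Rightarrow> ('m \<times> 'k \<Rightarrow> real) set" where
  "Theta \<zeta> m \<mu> = {h. integrable \<mu> h \<and> weighted h \<mu> \<in> Sinf \<zeta> m}"

end

theory Submission
  imports Defs
begin

text \<open>By \<open>PN = NP = 0\<close> and \<open>P\<^sup>2 = P\<close> one has \<open>F\<^sub>*\<^sup>n = P + N\<^sup>n\<close> on \<open>S\<^sup>\<infinity>\<close>. Disintegrating along the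
  leaves gives \<open>\<bar>\<integral>g d\<nu>\<bar> \<le> \<bar>g\<bar>\<^sub>\<zeta> \<parallel>\<nu>\<parallel>\<^sub>\<infinity>\<close>, so \<open>\<integral>g d(N\<^sup>n \<nu>)\<close> tends to 0 exponentially. With \<open>g = 1\<close>
  this shows that \<open>P\<close> preserves the total mass, and with \<open>\<nu> = \<mu>\<^sub>0 = F\<^sub>* \<mu>\<^sub>0\<close> that \<open>P \<mu>\<^sub>0\<close> and \<open>\<mu>\<^sub>0\<close> have the
  same integrals of Hoelder functions. As \<open>P\<close> has rank one, \<open>P \<nu> = \<nu>(\<Sigma>) P \<mu>\<^sub>0\<close>, so the correlation is
  exactly \<open>\<integral>g d(N\<^sup>n (h \<mu>\<^sub>0))\<close>.\<close>

section \<open>The Jordan decomposition\<close>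

text \<open>The obstacle is that \<open>signed_integral\<close> is defined through the Jordan
  decomposition, which is not additive in the measure: positive and negative mass may cancel in a
  sum or under a push-forward. Linearity and change of variables are therefore proved for finite
  sums over level sets, which see only the bare set function, and then passed to bounded limits. The
  Hahn and Jordan theorems come before that, because \<open>pos_part\<close> and
  \<open>neg_part\<close> are definite descriptions. The correlation enters because the integral of
  g over \<open>(push_forward F ^^ n) (weighted h \<mu>0)\<close> is the integral of g(F^n) h over
  \<mu>0. The constant is K0 |g| with no further factor, because |g| dominates both the supremum and
  the Hoelder constant that \<open>W_norm\<close> restricts, and m1 has mass one, so integrating
  over the leaves costs nothing.\<close>

lemma sm_apply_notin: "E \<notin> sets borel \<Longrightarrow> sm_apply \<mu> E = 0"
  using sm_apply[of \<mu>] by auto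

lemma sm_apply_sums:
  assumes "range A \<subseteq> sets borel" "disjoint_family A"
  shows "(\<lambda>n::nat. sm_apply \<mu> (A n)) sums sm_apply \<mu> (\<Union>n. A n)"
  using sm_apply[of \<mu>] assms by auto

text \<open>Countable additivity alone forces this: the constant sequence of empty sets is disjoint,
  and the terms of a convergent series tend to 0.\<close>

lemma sm_apply_empty [simp]: "sm_apply \<mu> {} = 0"
proof -
  have "(\<lambda>n::nat. sm_apply \<mu> {}) sums sm_apply \<mu> (\<Union>n::nat. {})"
    by (rule sm_apply_sums) (auto simp: disjoint_family_on_def)
  then have "(\<lambda>n::nat. sm_apply \<mu> {}) \<longlonglongrightarrow> 0"
    by (intro summable_LIMSEQ_zero) (rule sums_summable)
  then show ?thesis
    by (simp add: LIMSEQ_const_iff)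
qed

lemma sm_apply_Un:
  assumes "A \<in> sets borel" "B \<in> sets borel" "A \<inter> B = {}"
  shows "sm_apply \<mu> (A \<union> B) = sm_apply \<mu> A + sm_apply \<mu> B"
proof -
  have "(\<lambda>n. sm_apply \<mu> (binaryset A B n)) sums sm_apply \<mu> (\<Union>n. binaryset A B n)"
    using assms by (intro sm_apply_sums)
      (auto simp: range_binaryset_eq disjoint_family_on_def binaryset_def)
  moreover have "(\<lambda>n. sm_apply \<mu> (binaryset A B n)) sums (sm_apply \<mu> A + sm_apply \<mu> B)"
    by (rule binaryset_sums) simp
  ultimately show ?thesis
    using sums_unique2 by (fastforce simp: UN_binaryset_eq)
qed

lemma sm_apply_Diff:
  assumes "A \<in> sets borel" "B \<in> sets borel" "B \<subseteq> A"
  shows "sm_apply \<mu> (A - B) = sm_apply \<mu> A - sm_apply \<mu> B"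
proof -
  have "(A - B) \<inter> B = {}" by blast
  then show ?thesis
    using sm_apply_Un[of "A - B" B \<mu>] assms by (simp add: Un_absorb2)
qed

section \<open>The Hahn decomposition\<close>

definition sm_pos_set :: "'a::topological_space signed_measure \<Rightarrow> 'a set \<Rightarrow> bool" where
  "sm_pos_set \<mu> A \<longleftrightarrow> A \<in> sets borel \<and> (\<forall>B\<in>sets borel. B \<subseteq> A \<longrightarrow> 0 \<le> sm_apply \<mu> B)"

text \<open>If no such A existed, subsets of measure below -\<epsilon> could be removed from E
  forever. The removed sets are disjoint, so countable additivity would make a series converge whose
  terms stay away from 0.\<close>

lemma sm_almost_pos_subset:
  assumes E: "E \<in> sets borel" and "0 < \<epsilon>"
  obtains A where "A \<in> sets borel" "A \<subseteq> E" "sm_apply \<mu> E \<le> sm_apply \<mu> A"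
    "\<And>B. B \<in> sets borel \<Longrightarrow> B \<subseteq> A \<Longrightarrow> - \<epsilon> \<le> sm_apply \<mu> B"
proof (rule ccontr)
  \<comment> \<open>\<open>good\<close> survives each removal, because taking away a set of negative
    measure raises the measure of the rest.\<close>
  define good where "good A \<longleftrightarrow> A \<in> sets borel \<and> A \<subseteq> E \<and> sm_apply \<mu> E \<le> sm_apply \<mu> A" for A
  assume "\<not> thesis"
  then have "\<forall>A. good A \<longrightarrow> (\<exists>B. B \<in> sets borel \<and> B \<subseteq> A \<and> sm_apply \<mu> B < - \<epsilon>)"
    using that unfolding good_def by (meson not_le)
  then obtain b where b: "\<And>A. good A \<Longrightarrow> b A \<in> sets borel \<and> b A \<subseteq> A \<and> sm_apply \<mu> (b A) < - \<epsilon>"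
    by metis
  define S where "S = rec_nat E (\<lambda>_ A. A - b A)"
  have S: "S 0 = E" "S (Suc k) = S k - b (S k)" for k
    by (simp_all add: S_def)
  have good: "good (S k)" for k
  proof (induction k)
    case 0
    then show ?case using E by (simp add: S good_def)
  next
    case (Suc k)
    then show ?case
      using b[OF Suc] \<open>0 < \<epsilon>\<close> sm_apply_Diff[of "S k" "b (S k)" \<mu>] by (auto simp: S good_def)
  qed
  have anti: "S l \<subseteq> S k" if "k \<le> l" for k l
    using that by (induction rule: dec_induct) (auto simp: S)
  have "disjoint_family (\<lambda>k. b (S k))"
  proof -
    have "b (S k) \<inter> b (S l) = {}" if "k < l" for k l
      using b[OF good[of l]] anti[of "Suc k" l] that by (auto simp: S)
    then show ?thesis
      unfolding disjoint_family_on_def by (metis Int_commute nat_neq_iff)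
  qed
  then have "(\<lambda>k. sm_apply \<mu> (b (S k))) sums sm_apply \<mu> (\<Union>k. b (S k))"
    using b[OF good] by (intro sm_apply_sums) auto
  then have "(\<lambda>k. sm_apply \<mu> (b (S k))) \<longlonglongrightarrow> 0"
    by (intro summable_LIMSEQ_zero) (rule sums_summable)
  then have "0 \<le> - \<epsilon>"
    using b[OF good] by (intro LIMSEQ_le_const2) (auto intro: less_imp_le)
  then show False
    using \<open>0 < \<epsilon>\<close> by simp
qed

text \<open>\<open>sm_almost_pos_subset\<close> is iterated with tolerances 1/(k+1). A subset of the
  intersection of the resulting sets obeys all these bounds at once, so its measure is
  nonnegative.\<close>

lemma sm_pos_subset:
  assumes E: "E \<in> sets borel"
  obtains A where "sm_pos_set \<mu> A" "A \<subseteq> E" "sm_apply \<mu> E \<le> sm_apply \<mu> A"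
proof -
  \<comment> \<open>\<open>Suc k\<close> keeps the tolerance positive at k = 0, since 1/0 is
    0.\<close>
  define Q where "Q k A B \<longleftrightarrow> B \<in> sets borel \<and> B \<subseteq> A \<and> sm_apply \<mu> A \<le> sm_apply \<mu> B \<and>
      (\<forall>C\<in>sets borel. C \<subseteq> B \<longrightarrow> - (1 / Suc k) \<le> sm_apply \<mu> C)" for k :: nat and A B
  have ex: "\<exists>B. Q k A B" if "A \<in> sets borel" for A k
    by (rule sm_almost_pos_subset[OF that, of "1 / Suc k" \<mu>]) (auto simp: Q_def)
  define c where "c k A = (SOME B. Q k A B)" for k A
  have Q_c: "Q k A (c k A)" if "A \<in> sets borel" for A k
    unfolding c_def by (rule someI_ex[OF ex[OF that]])
  have c: "c k A \<in> sets borel \<and> c k A \<subseteq> A \<and> sm_apply \<mu> A \<le> sm_apply \<mu> (c k A) \<and>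
      (\<forall>C\<in>sets borel. C \<subseteq> c k A \<longrightarrow> - (1 / Suc k) \<le> sm_apply \<mu> C)"
    if "A \<in> sets borel" for A k
    using Q_c[OF that] unfolding Q_def .
  define S where "S = rec_nat E c"
  have S: "S 0 = E" "S (Suc k) = c k (S k)" for k
    by (simp_all add: S_def)
  have borel: "S k \<in> sets borel" for k
    by (induction k) (use E c in \<open>auto simp: S\<close>)
  have step: "S (Suc k) \<subseteq> S k" "sm_apply \<mu> (S k) \<le> sm_apply \<mu> (S (Suc k))" for k
    using c[OF borel] by (simp_all add: S)
  have anti: "S l \<subseteq> S k" if "k \<le> l" for k l
    using that by (induction rule: dec_induct) (use step in auto)
  define A where "A = (\<Inter>k. S k)"
  have A: "A \<in> sets borel" "A \<subseteq> E"
    using borel S(1) by (auto simp: A_def)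
  have pos: "0 \<le> sm_apply \<mu> B" if "B \<in> sets borel" "B \<subseteq> A" for B
  proof (rule LIMSEQ_le_const2)
    show "(\<lambda>k. - (1 / Suc k)) \<longlonglongrightarrow> (0::real)"
      using tendsto_minus[OF LIMSEQ_Suc[OF lim_1_over_n]] by simp
    have "- (1 / Suc k) \<le> sm_apply \<mu> B" for k
    proof -
      have "B \<subseteq> c k (S k)"
        using that(2) S(2)[of k] by (auto simp: A_def)
      then show ?thesis
        using c[OF borel[of k], of k] that(1) by blast
    qed
    then show "\<exists>N. \<forall>n\<ge>N. - (1 / Suc n) \<le> sm_apply \<mu> B"
      by blast
  qed
  \<comment> \<open>Signed measures are not monotone, so the bound for A comes from the layers
    between consecutive sets: each has measure at most 0, and together they make up E - A.\<close>
  have "(\<Union>k. S k - S (Suc k)) = E - A"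
  proof -
    have "x \<in> (\<Union>k. S k - S (Suc k))" if "x \<in> E" "x \<notin> A" for x
    proof (rule ccontr)
      assume *: "x \<notin> (\<Union>k. S k - S (Suc k))"
      have "x \<in> S k" for k
        by (induction k) (use * that S(1) in auto)
      then show False
        using that by (simp add: A_def)
    qed
    then show ?thesis
      using anti[of 0] S(1) by (fastforce simp: A_def)
  qed
  moreover have "disjoint_family (\<lambda>k. S k - S (Suc k))"
  proof -
    have "(S k - S (Suc k)) \<inter> (S l - S (Suc l)) = {}" if "k < l" for k l
      using anti[of "Suc k" l] that by auto
    then show ?thesis
      unfolding disjoint_family_on_def by (metis Int_commute nat_neq_iff)
  qed
  ultimately have *: "(\<lambda>k. sm_apply \<mu> (S k - S (Suc k))) sums sm_apply \<mu> (E - A)"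
    using sm_apply_sums[of "\<lambda>k. S k - S (Suc k)" \<mu>] borel by auto
  have "sm_apply \<mu> (S k - S (Suc k)) \<le> 0" for k
    using step[of k] borel by (simp add: sm_apply_Diff)
  then have "sm_apply \<mu> (E - A) \<le> 0"
    by (rule sums_le[OF _ * sums_zero])
  then have "sm_apply \<mu> E \<le> sm_apply \<mu> A"
    using sm_apply_Diff[OF E A(1,2), of \<mu>] by simp
  moreover have "sm_pos_set \<mu> A"
    using A(1) pos by (simp add: sm_pos_set_def)
  ultimately show thesis
    using that A(2) by blast
qed

text \<open>A subset of the union is cut along \<open>disjointed P\<close>: each piece lies in a
  single P n, where measures are nonnegative, and the pieces add up.\<close>

lemma sm_pos_set_UN:
  fixes P :: "nat \<Rightarrow> 'a::topological_space set"
  assumes "\<And>n. sm_pos_set \<mu> (P n)"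
  shows "sm_pos_set \<mu> (\<Union>n. P n)"
  unfolding sm_pos_set_def
proof (intro conjI ballI impI)
  show "(\<Union>n. P n) \<in> sets borel"
    using assms by (auto simp: sm_pos_set_def)
next
  fix B assume B: "B \<in> sets borel" "B \<subseteq> (\<Union>n. P n)"
  have D: "disjointed P n \<in> sets borel" for n
    using sets.range_disjointed_sets[of P borel] assms by (auto simp: sm_pos_set_def)
  have "(\<lambda>n. sm_apply \<mu> (B \<inter> disjointed P n)) sums sm_apply \<mu> (\<Union>n. B \<inter> disjointed P n)"
    using disjoint_family_disjointed[of P] B D
    by (intro sm_apply_sums) (auto simp: disjoint_family_on_def)
  also have "(\<Union>n. B \<inter> disjointed P n) = B"
    using B UN_disjointed_eq[of P] by blast
  finally have *: "(\<lambda>n. sm_apply \<mu> (B \<inter> disjointed P n)) sums sm_apply \<mu> B" .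
  have "0 \<le> sm_apply \<mu> (B \<inter> disjointed P n)" for n
  proof -
    have "B \<inter> disjointed P n \<subseteq> P n"
      using disjointed_subset[of P n] by blast
    then show ?thesis
      using assms[of n] B D[of n] by (simp add: sm_pos_set_def)
  qed
  then show "0 \<le> sm_apply \<mu> B"
    by (rule sums_le[OF _ sums_zero *])
qed

lemma sm_pos_set_mono:
  assumes "sm_pos_set \<mu> P" "A \<in> sets borel" "A \<subseteq> P"
  shows "sm_apply \<mu> A \<le> sm_apply \<mu> P"
proof -
  have "0 \<le> sm_apply \<mu> (P - A)"
    using assms by (auto simp: sm_pos_set_def)
  then show ?thesis
    using assms sm_apply_Diff[of P A \<mu>] by (simp add: sm_pos_set_def)
qed

text \<open>The positive set of maximal measure is the positive part of the space.\<close>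

lemma sm_hahn_decomposition:
  obtains P where "P \<in> sets borel"
    "\<And>B. B \<in> sets borel \<Longrightarrow> B \<subseteq> P \<Longrightarrow> 0 \<le> sm_apply \<mu> B"
    "\<And>B. B \<in> sets borel \<Longrightarrow> B \<subseteq> - P \<Longrightarrow> sm_apply \<mu> B \<le> 0"
proof -
  \<comment> \<open>Values are taken in \<open>ereal\<close> so that the supremum exists before it
    is known to be finite; the union of a maximising sequence then attains it.\<close>
  define V where "V = (\<lambda>P. ereal (sm_apply \<mu> P)) ` {P. sm_pos_set \<mu> P}"
  have "sm_pos_set \<mu> {}"
    by (auto simp: sm_pos_set_def)
  then have "V \<noteq> {}"
    by (auto simp: V_def)
  from Sup_countable_SUP[OF this] obtain v :: "nat \<Rightarrow> ereal"
    where v: "range v \<subseteq> V" "Sup V = (SUP i. v i)"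
    by auto
  then have "\<exists>P. sm_pos_set \<mu> P \<and> v i = ereal (sm_apply \<mu> P)" for i
    by (auto simp: V_def image_subset_iff image_iff)
  then obtain Q where Q: "\<And>i. sm_pos_set \<mu> (Q i)" "\<And>i. v i = ereal (sm_apply \<mu> (Q i))"
    by metis
  define P where "P = (\<Union>i. Q i)"
  have P: "sm_pos_set \<mu> P"
    unfolding P_def by (rule sm_pos_set_UN) (rule Q)
  have "v i \<le> ereal (sm_apply \<mu> P)" for i
    using sm_pos_set_mono[OF P, of "Q i"] Q[of i] by (auto simp: P_def sm_pos_set_def)
  then have "Sup V \<le> ereal (sm_apply \<mu> P)"
    unfolding v(2) by (rule SUP_least)
  then have max: "sm_apply \<mu> A \<le> sm_apply \<mu> P" if "sm_pos_set \<mu> A" for A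
    using that by (auto simp: V_def Sup_le_iff)
  have "sm_apply \<mu> B \<le> 0" if B: "B \<in> sets borel" "B \<subseteq> - P" for B
  proof -
    \<comment> \<open>A positive set outside P with positive measure could be added to P, against
      maximality. So A, and with it B, has measure at most 0.\<close>
    obtain A where A: "sm_pos_set \<mu> A" "A \<subseteq> B" "sm_apply \<mu> B \<le> sm_apply \<mu> A"
      using sm_pos_subset[OF B(1)] by blast
    \<comment> \<open>\<open>sm_pos_set_UN\<close> speaks of sequences, so the union of two sets is
      written as that of a two-valued sequence.\<close>
    have "sm_pos_set \<mu> (\<Union>n::nat. if n = 0 then P else A)"
      using A P by (intro sm_pos_set_UN) auto
    also have "(\<Union>n::nat. if n = 0 then P else A) = P \<union> A"
      by (auto split: if_splits)
    finally have "sm_apply \<mu> (P \<union> A) \<le> sm_apply \<mu> P"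
      by (rule max)
    moreover have "sm_apply \<mu> (P \<union> A) = sm_apply \<mu> P + sm_apply \<mu> A"
      using A P B by (intro sm_apply_Un) (auto simp: sm_pos_set_def)
    ultimately show ?thesis
      using A(3) by simp
  qed
  then show thesis
    using that[of P] P unfolding sm_pos_set_def by blast
qed

section \<open>Existence and uniqueness of the Jordan decomposition\<close>

lemma signed_of_apply:
  "finite_measure p \<Longrightarrow> sets p = sets borel \<Longrightarrow> sm_apply (signed_of p) E = measure p E"
  by (simp add: signed_of.rep_eq)

text \<open>The way back from a nonnegative signed measure to the type \<open>measure\<close>, on
  which the Lebesgue integral lives.\<close>

lemma finite_measure_of_signed:
  fixes \<mu> :: "'a::topological_space signed_measure"
  assumes "\<And>B. B \<in> sets borel \<Longrightarrow> 0 \<le> sm_apply \<mu> B"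
  obtains p where "finite_measure p" "sets p = sets borel"
    "\<And>E. E \<in> sets borel \<Longrightarrow> measure p E = sm_apply \<mu> E"
proof -
  define p where "p = measure_of UNIV (sets borel) (\<lambda>E. ennreal (sm_apply \<mu> E))"
  have sa: "sigma_algebra UNIV (sets (borel :: 'a measure))"
    using sets.sigma_algebra_axioms[of "borel :: 'a measure"] by simp
  have sets: "sets p = sets borel"
    unfolding p_def by (rule sigma_algebra.sets_measure_of_eq[OF sa])
  have em: "emeasure p E = ennreal (sm_apply \<mu> E)" if "E \<in> sets borel" for E
    unfolding p_def
  proof (rule emeasure_measure_of_sigma[OF sa])
    show "positive (sets borel) (\<lambda>E. ennreal (sm_apply \<mu> E))"
      by (simp add: positive_def)
    show "countably_additive (sets borel) (\<lambda>E. ennreal (sm_apply \<mu> E))"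
    proof (rule countably_additiveI)
      fix A :: "nat \<Rightarrow> 'a set"
      assume A: "range A \<subseteq> sets borel" "disjoint_family A"
      then have "(\<lambda>n. sm_apply \<mu> (A n)) sums sm_apply \<mu> (\<Union>n. A n)"
        by (rule sm_apply_sums)
      then show "(\<Sum>i. ennreal (sm_apply \<mu> (A i))) = ennreal (sm_apply \<mu> (\<Union> (range A)))"
        using A assms by (intro suminf_ennreal_eq) auto
    qed
  qed (fact that)
  show thesis
  proof
    show "finite_measure p"
      using em[of UNIV] sets_eq_imp_space_eq[OF sets] by (intro finite_measureI) simp
    show "measure p E = sm_apply \<mu> E" if "E \<in> sets borel" for E
      using em[OF that] assms[OF that] by (simp add: measure_def)
  qed (fact sets)
qed

text \<open>Serves to cut a signed measure along a Hahn set. The default value 0 keeps the result in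
  the type, whose elements vanish outside the Borel sets.\<close>

lift_definition sm_restrict :: "'a::topological_space set \<Rightarrow> 'a signed_measure \<Rightarrow> 'a signed_measure" is
  "\<lambda>A \<mu> E. if A \<in> sets borel \<and> E \<in> sets borel then \<mu> (A \<inter> E) else 0"
proof -
  fix A :: "'a set" and \<mu> :: "'a set \<Rightarrow> real"
  assume \<mu>: "(\<forall>E. E \<notin> sets borel \<longrightarrow> \<mu> E = 0) \<and>
     (\<forall>A::nat \<Rightarrow> 'a set. range A \<subseteq> sets borel \<longrightarrow> disjoint_family A \<longrightarrow>
        (\<lambda>n. \<mu> (A n)) sums \<mu> (\<Union>n. A n))"
  have "(\<lambda>n. \<mu> (A \<inter> B n)) sums \<mu> (A \<inter> (\<Union>n. B n))"
    if "A \<in> sets borel" "range B \<subseteq> sets borel" "disjoint_family B" for B :: "nat \<Rightarrow> 'a set"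
  proof -
    have "range (\<lambda>n. A \<inter> B n) \<subseteq> sets borel" "disjoint_family (\<lambda>n. A \<inter> B n)"
      using that by (auto simp: disjoint_family_on_def)
    then have "(\<lambda>n. \<mu> (A \<inter> B n)) sums \<mu> (\<Union>n. A \<inter> B n)"
      using \<mu> by blast
    then show ?thesis
      by simp
  qed
  then show "(\<forall>E. E \<notin> sets borel \<longrightarrow>
      (if A \<in> sets borel \<and> E \<in> sets borel then \<mu> (A \<inter> E) else 0) = 0) \<and>
    (\<forall>B::nat \<Rightarrow> 'a set. range B \<subseteq> sets borel \<longrightarrow> disjoint_family B \<longrightarrow>
      (\<lambda>n. if A \<in> sets borel \<and> B n \<in> sets borel then \<mu> (A \<inter> B n) else 0) sums
      (if A \<in> sets borel \<and> (\<Union>n. B n) \<in> sets borel then \<mu> (A \<inter> (\<Union>n. B n)) else 0))"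
    by (auto simp: image_subset_iff)
qed

text \<open>The parts are \<mu> cut along a Hahn set and -\<mu> cut along its complement; the same
  set witnesses their mutual singularity.\<close>

lemma jordan_decomposition_exists: "\<exists>p n. jordan_decomposition \<mu> p n"
proof -
  obtain P where P: "P \<in> sets borel"
    "\<And>B. B \<in> sets borel \<Longrightarrow> B \<subseteq> P \<Longrightarrow> 0 \<le> sm_apply \<mu> B"
    "\<And>B. B \<in> sets borel \<Longrightarrow> B \<subseteq> - P \<Longrightarrow> sm_apply \<mu> B \<le> 0"
    using sm_hahn_decomposition by blast
  obtain p where p: "finite_measure p" "sets p = sets borel"
    "\<And>E. E \<in> sets borel \<Longrightarrow> measure p E = sm_apply (sm_restrict P \<mu>) E"
    using P by (rule_tac finite_measure_of_signed[of "sm_restrict P \<mu>"]) (auto simp: sm_restrict.rep_eq)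
  obtain n where n: "finite_measure n" "sets n = sets borel"
    "\<And>E. E \<in> sets borel \<Longrightarrow> measure n E = sm_apply (- sm_restrict (- P) \<mu>) E"
    using P by (rule_tac finite_measure_of_signed[of "- sm_restrict (- P) \<mu>"])
      (auto simp: sm_restrict.rep_eq uminus_signed_measure.rep_eq)
  have "\<mu> = signed_of p - signed_of n"
  proof (rule sm_apply_inject[THEN iffD1], rule ext)
    fix E
    show "sm_apply \<mu> E = sm_apply (signed_of p - signed_of n) E"
    proof (cases "E \<in> sets borel")
      case True
      have "sm_apply \<mu> ((P \<inter> E) \<union> (- P \<inter> E)) = sm_apply \<mu> (P \<inter> E) + sm_apply \<mu> (- P \<inter> E)"
        using True P by (intro sm_apply_Un) auto
      moreover have "(P \<inter> E) \<union> (- P \<inter> E) = E"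
        by blast
      ultimately show ?thesis
        using True P p n by (simp add: minus_signed_measure.rep_eq signed_of_apply
            sm_restrict.rep_eq uminus_signed_measure.rep_eq)
    next
      case False
      then show ?thesis by (simp add: sm_apply_notin)
    qed
  qed
  moreover have "emeasure p (- P) = 0" "emeasure n P = 0"
    using P p n by (auto simp: finite_measure.emeasure_eq_measure sm_restrict.rep_eq
        uminus_signed_measure.rep_eq)
  ultimately show ?thesis
    using p n P(1) unfolding jordan_decomposition_def by blast
qed

text \<open>The positive part of \<open>\<mu>\<close> is determined as \<open>p E = max {\<mu> B | B \<subseteq> E}\<close>.\<close>

lemma jordan_decomposition_le:
  assumes "jordan_decomposition \<mu> p n" "jordan_decomposition \<mu> p' n'" "E \<in> sets borel"
  shows "measure p E \<le> measure p' E"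
proof -
  interpret p: finite_measure p using assms by (simp add: jordan_decomposition_def)
  interpret n: finite_measure n using assms by (simp add: jordan_decomposition_def)
  interpret p': finite_measure p' using assms by (simp add: jordan_decomposition_def)
  interpret n': finite_measure n' using assms by (simp add: jordan_decomposition_def)
  have [simp]: "sets p = sets borel" "sets n = sets borel" "sets p' = sets borel" "sets n' = sets borel"
    and \<mu>: "\<mu> = signed_of p - signed_of n" "\<mu> = signed_of p' - signed_of n'"
    using assms by (simp_all add: jordan_decomposition_def)
  obtain A where A: "A \<in> sets borel" "emeasure p (- A) = 0" "emeasure n A = 0"
    using assms(1) unfolding jordan_decomposition_def by blast
  have "measure p (E - A) \<le> measure p (- A)"
    using A by (intro p.finite_measure_mono) auto
  moreover have "measure p (- A) = 0"
    using A by (simp add: measure_def)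
  ultimately have "measure p (E - A) = 0"
    using measure_nonneg[of p "E - A"] by linarith
  then have "measure p E = measure p (E \<inter> A)"
    using p.finite_measure_Diff'[of E A] A assms(3) by simp
  moreover have "measure n (E \<inter> A) \<le> measure n A"
    using A by (intro n.finite_measure_mono) auto
  then have "measure n (E \<inter> A) = 0"
    using A measure_nonneg[of n "E \<inter> A"] by (simp add: measure_eq_emeasure_eq_ennreal[of 0 n A])
  \<comment> \<open>Both sides are the value of \<mu> at E \<inter> A. On the left the n-term is 0
    and the p-term is all of p E; on the right, dropping n' can only increase the value.\<close>
  moreover have "measure p (E \<inter> A) - measure n (E \<inter> A) = measure p' (E \<inter> A) - measure n' (E \<inter> A)"
    using arg_cong[where f = "\<lambda>\<nu>. sm_apply \<nu> (E \<inter> A)", OF trans[OF \<mu>(1)[symmetric] \<mu>(2)]]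
    by (simp add: minus_signed_measure.rep_eq signed_of_apply p.finite_measure_axioms
        n.finite_measure_axioms p'.finite_measure_axioms n'.finite_measure_axioms)
  moreover have "measure p' (E \<inter> A) \<le> measure p' E"
    using assms(3) by (intro p'.finite_measure_mono) auto
  ultimately show ?thesis
    using measure_nonneg[of n' "E \<inter> A"] by linarith
qed

lemma jordan_decomposition_unique_pos:
  assumes "jordan_decomposition \<mu> p n" "jordan_decomposition \<mu> p' n'"
  shows "p = p'"
proof (rule measure_eqI)
  have *: "finite_measure p" "finite_measure p'" "sets p = sets borel" "sets p' = sets borel"
    using assms by (simp_all add: jordan_decomposition_def)
  then show "sets p = sets p'" by simp
  fix E assume "E \<in> sets p"
  then have "measure p E = measure p' E"
    using jordan_decomposition_le[OF assms] jordan_decomposition_le[OF assms(2,1)] *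
    by (intro antisym) auto
  then show "emeasure p E = emeasure p' E"
    using * by (simp add: finite_measure.emeasure_eq_measure)
qed

lemma jordan_decomposition_uminus:
  assumes "jordan_decomposition \<mu> p n"
  shows "jordan_decomposition (- \<mu>) n p"
proof -
  obtain A where "A \<in> sets borel" "emeasure p (- A) = 0" "emeasure n A = 0"
    using assms unfolding jordan_decomposition_def by blast
  then have "\<exists>B\<in>sets borel. emeasure n (- B) = 0 \<and> emeasure p B = 0"
    by (intro bexI[of _ "- A"]) auto
  then show ?thesis
    using assms by (simp add: jordan_decomposition_def)
qed

lemma jordan_decomposition_unique_neg:
  assumes "jordan_decomposition \<mu> p n" "jordan_decomposition \<mu> p' n'"
  shows "n = n'"
  using assms[THEN jordan_decomposition_uminus] by (rule jordan_decomposition_unique_pos)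

text \<open>Existence together with uniqueness of each part is what the definite descriptions behind
  \<open>pos_part\<close> and \<open>neg_part\<close> require.\<close>

lemma jordan_decomposition_pos_neg: "jordan_decomposition \<mu> (pos_part \<mu>) (neg_part \<mu>)"
proof -
  obtain p n where pn: "jordan_decomposition \<mu> p n"
    using jordan_decomposition_exists by blast
  have "pos_part \<mu> = p"
    unfolding pos_part_def by (rule the_equality) (use pn jordan_decomposition_unique_pos in blast)+
  moreover have "neg_part \<mu> = n"
    unfolding neg_part_def by (rule the_equality) (use pn jordan_decomposition_unique_neg in blast)+
  ultimately show ?thesis
    using pn by simp
qed

lemma
  shows finite_pos_part: "finite_measure (pos_part \<mu>)"
    and sets_pos_part [simp]: "sets (pos_part \<mu>) = sets borel"
    and finite_neg_part: "finite_measure (neg_part \<mu>)"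
    and sets_neg_part [simp]: "sets (neg_part \<mu>) = sets borel"
    and pos_part_minus_neg_part: "signed_of (pos_part \<mu>) - signed_of (neg_part \<mu>) = \<mu>"
  using jordan_decomposition_pos_neg[of \<mu>] by (simp_all add: jordan_decomposition_def)

lemma sm_apply_eq_pos_neg: "sm_apply \<mu> E = measure (pos_part \<mu>) E - measure (neg_part \<mu>) E"
  using arg_cong[where f = "\<lambda>\<nu>. sm_apply \<nu> E", OF pos_part_minus_neg_part[of \<mu>]]
  by (simp add: minus_signed_measure.rep_eq signed_of_apply finite_pos_part finite_neg_part)

section \<open>Integration against signed measures\<close>

text \<open>The set function is arbitrary so that one formula serves \<open>sm_apply \<mu>\<close>,
  \<open>measure p\<close> and the indefinite integral of h.\<close>

definition simple_sum :: "('a set \<Rightarrow> real) \<Rightarrow> ('a \<Rightarrow> real) \<Rightarrow> real" where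
  "simple_sum \<nu> s = (\<Sum>y\<in>range s. y * \<nu> (s -` {y}))"

text \<open>The uniform bound provides the majorant for dominated convergence.\<close>

definition simple_approx :: "(nat \<Rightarrow> 'a::topological_space \<Rightarrow> real) \<Rightarrow> ('a \<Rightarrow> real) \<Rightarrow> bool" where
  "simple_approx s g \<longleftrightarrow> (\<forall>i. finite (range (s i)) \<and> s i \<in> borel_measurable borel) \<and>
     (\<exists>C. \<forall>i x. \<bar>s i x\<bar> \<le> C) \<and> (\<forall>x. (\<lambda>i. s i x) \<longlonglongrightarrow> g x)"

text \<open>The test functions have to be integrable against both Jordan parts and stable under
  composition with a merely Borel map, which Hoelder functions in general are not.\<close>

definition bounded_borel :: "('a::topological_space \<Rightarrow> real) \<Rightarrow> bool" where
  "bounded_borel g \<longleftrightarrow> g \<in> borel_measurable borel \<and> (\<exists>C. \<forall>x. \<bar>g x\<bar> \<le> C)"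

lemma bounded_borel_const [simp]: "bounded_borel (\<lambda>_. c)"
  by (auto simp: bounded_borel_def)

lemma bounded_borel_compose:
  "bounded_borel g \<Longrightarrow> F \<in> borel_measurable borel \<Longrightarrow> bounded_borel (\<lambda>x. g (F x))"
  by (auto simp: bounded_borel_def intro: measurable_compose)

lemma bounded_borel_integrable:
  assumes g: "bounded_borel g" and p: "finite_measure p" "sets p = sets borel"
  shows "integrable p g"
proof -
  obtain C where "\<And>x. \<bar>g x\<bar> \<le> C" and "g \<in> borel_measurable borel"
    using g by (auto simp: bounded_borel_def)
  then show ?thesis
    using p(2) by (intro finite_measure.integrable_const_bound[OF p(1), of _ C])
      (simp_all add: measurable_cong_sets[of p borel])
qed

lemma simple_approx_exists:
  assumes "bounded_borel g"
  obtains s where "simple_approx s g"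
proof -
  obtain C where C: "\<And>x. \<bar>g x\<bar> \<le> C" and g: "g \<in> borel_measurable borel"
    using assms by (auto simp: bounded_borel_def)
  \<comment> \<open>The argument 0 is the reference point: the distance of s i x to it is at most
    twice that of g x, which yields the uniform bound 2 * C.\<close>
  obtain s where s: "\<And>i. simple_function borel (s i)" "\<And>x. (\<lambda>i. s i x) \<longlonglongrightarrow> g x"
    "\<And>i x. \<bar>s i x\<bar> \<le> 2 * \<bar>g x\<bar>"
    using borel_measurable_implies_sequence_metric[OF g, of 0] by (auto simp: dist_real_def)
  have "\<bar>s i x\<bar> \<le> 2 * C" for i x
    using s(3)[of i x] C[of x] by linarith
  then have "simple_approx s g"
    using s(1,2) simple_functionD(1)[OF s(1)] borel_measurable_simple_function[OF s(1)]
    unfolding simple_approx_def by auto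
  then show thesis ..
qed

text \<open>The weight h is carried along because h = 1 gives the plain measure and a general h
  gives \<open>weighted\<close>.\<close>

lemma simple_sum_set_integral:
  fixes p :: "'a::topological_space measure"
  assumes "sets p = sets borel" "integrable p h"
    and s: "finite (range s)" "s \<in> borel_measurable borel"
  shows "simple_sum (\<lambda>E. LINT x:E|p. h x) s = (LINT x|p. s x * h x)"
proof -
  have E: "s -` {y} \<in> sets p" for y
    using measurable_sets[OF s(2), of "{y}"] assms(1) by simp
  have "s x * h x = (\<Sum>y\<in>range s. y * (indicator (s -` {y}) x * h x))" for x
  proof -
    have "(\<Sum>y\<in>range s. y * (indicator (s -` {y}) x * h x)) =
        (\<Sum>y\<in>range s. if y = s x then s x * h x else 0)"
      by (rule sum.cong) (auto simp: indicator_def)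
    then show ?thesis
      using s(1) by simp
  qed
  then have "(LINT x|p. s x * h x) = (LINT x|p. (\<Sum>y\<in>range s. y * (indicator (s -` {y}) x * h x)))"
    by simp
  also have "\<dots> = (\<Sum>y\<in>range s. LINT x|p. y * (indicator (s -` {y}) x * h x))"
    using assms(2) E by (intro Bochner_Integration.integral_sum)
      (auto intro!: integrable_mult_indicator[where 'b = real, simplified real_scaleR_def])
  finally show ?thesis
    by (simp add: simple_sum_def set_lebesgue_integral_def)
qed

text \<open>The majorant is C |h|, so h itself may be unbounded.\<close>

lemma simple_sum_set_integral_limit:
  fixes p :: "'a::topological_space measure"
  assumes p: "sets p = sets borel" and h: "integrable p h" and s: "simple_approx s g"
  shows "(\<lambda>i. simple_sum (\<lambda>E. LINT x:E|p. h x) (s i)) \<longlonglongrightarrow> (LINT x|p. g x * h x)"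
proof -
  obtain C where C: "\<And>i x. \<bar>s i x\<bar> \<le> C"
    using s by (auto simp: simple_approx_def)
  have lim: "\<And>x. (\<lambda>i. s i x) \<longlonglongrightarrow> g x" and fin: "\<And>i. finite (range (s i))"
    and [measurable]: "\<And>i. s i \<in> borel_measurable p"
    using s p by (auto simp: simple_approx_def measurable_cong_sets[of p borel])
  have [measurable]: "g \<in> borel_measurable p"
    using lim by (rule borel_measurable_LIMSEQ_real) measurable
  have [measurable]: "h \<in> borel_measurable p"
    using h by simp
  have "(\<lambda>i. LINT x|p. s i x * h x) \<longlonglongrightarrow> (LINT x|p. g x * h x)"
  proof (rule integral_dominated_convergence[where w = "\<lambda>x. C * \<bar>h x\<bar>"])
    show "integrable p (\<lambda>x. C * \<bar>h x\<bar>)"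
      using h by simp
    show "AE x in p. (\<lambda>i. s i x * h x) \<longlonglongrightarrow> g x * h x"
      using lim by (intro AE_I2 tendsto_mult) auto
    show "AE x in p. norm (s i x * h x) \<le> C * \<bar>h x\<bar>" for i
      using C[of i] by (intro AE_I2) (simp add: abs_mult mult_right_mono)
  qed measurable
  moreover have "simple_sum (\<lambda>E. LINT x:E|p. h x) (s i) = (LINT x|p. s i x * h x)" for i
    using s by (intro simple_sum_set_integral[OF p h]) (auto simp: simple_approx_def)
  ultimately show ?thesis
    by simp
qed

lemma simple_sum_cong:
  assumes "\<And>E. E \<in> sets borel \<Longrightarrow> \<nu> E = \<nu>' E" "s \<in> borel_measurable borel"
  shows "simple_sum \<nu> s = simple_sum \<nu>' s"
  unfolding simple_sum_def
  using assms measurable_sets[OF assms(2), of "{y}" for y] by (intro sum.cong) auto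

lemma simple_sum_measure:
  fixes p :: "'a::topological_space measure"
  assumes p: "sets p = sets borel" "finite_measure p"
    and s: "finite (range s)" "s \<in> borel_measurable borel"
  shows "simple_sum (measure p) s = (LINT x|p. s x)"
proof -
  have "simple_sum (measure p) s = simple_sum (\<lambda>E. LINT x:E|p. 1) s"
  proof (rule simple_sum_cong)
    show "measure p E = (LINT x:E|p. 1)" if "E \<in> sets borel" for E
      using that p by (simp add: set_lebesgue_integral_def sets_eq_imp_space_eq[OF p(1)])
  qed (fact s(2))
  then show ?thesis
    using simple_sum_set_integral[OF p(1) _ s, of "\<lambda>_. 1"] p(2)
    by (simp add: finite_measure.integrable_const)
qed

lemma simple_sum_measure_limit:
  fixes p :: "'a::topological_space measure"
  assumes p: "sets p = sets borel" "finite_measure p" and s: "simple_approx s g"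
  shows "(\<lambda>i. simple_sum (measure p) (s i)) \<longlonglongrightarrow> (LINT x|p. g x)"
proof -
  have "simple_sum (measure p) (s i) = simple_sum (\<lambda>E. LINT x:E|p. 1) (s i)" for i
  proof -
    have i: "finite (range (s i))" "s i \<in> borel_measurable borel"
      using s by (simp_all add: simple_approx_def)
    show ?thesis
      using simple_sum_measure[OF p i] simple_sum_set_integral[OF p(1) _ i, of "\<lambda>_. 1"] p(2)
      by (simp add: finite_measure.integrable_const)
  qed
  then show ?thesis
    using simple_sum_set_integral_limit[OF p(1) _ s, of "\<lambda>_. 1"] p(2)
    by (simp add: finite_measure.integrable_const)
qed

text \<open>The left-hand side does not involve the Jordan decomposition and is linear in \<open>\<mu>\<close>, so the
  algebraic rules for \<^const>\<open>signed_integral\<close> follow by passing to the limit.\<close>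

lemma signed_integral_limit:
  assumes "simple_approx s g"
  shows "(\<lambda>i. simple_sum (sm_apply \<mu>) (s i)) \<longlonglongrightarrow> signed_integral \<mu> g"
proof -
  have "simple_sum (sm_apply \<mu>) (s i) =
      simple_sum (measure (pos_part \<mu>)) (s i) - simple_sum (measure (neg_part \<mu>)) (s i)" for i
    by (simp add: simple_sum_def sm_apply_eq_pos_neg sum_subtractf algebra_simps)
  then show ?thesis
    unfolding signed_integral_def
    by (simp add: tendsto_diff simple_sum_measure_limit assms finite_pos_part finite_neg_part)
qed

lemma signed_integral_add:
  assumes "bounded_borel g"
  shows "signed_integral (\<mu> + \<nu>) g = signed_integral \<mu> g + signed_integral \<nu> g"
proof -
  obtain s where s: "simple_approx s g"
    using simple_approx_exists[OF assms] .
  have "simple_sum (sm_apply (\<mu> + \<nu>)) (s i) =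
      simple_sum (sm_apply \<mu>) (s i) + simple_sum (sm_apply \<nu>) (s i)" for i
    by (simp add: simple_sum_def plus_signed_measure.rep_eq sum.distrib algebra_simps)
  then show ?thesis
    using signed_integral_limit[OF s, of "\<mu> + \<nu>"]
      tendsto_add[OF signed_integral_limit[OF s, of \<mu>] signed_integral_limit[OF s, of \<nu>]]
    by (simp add: LIMSEQ_unique)
qed

lemma signed_integral_scaleR:
  assumes "bounded_borel g"
  shows "signed_integral (c *\<^sub>R \<mu>) g = c * signed_integral \<mu> g"
proof -
  obtain s where s: "simple_approx s g"
    using simple_approx_exists[OF assms] .
  have "simple_sum (sm_apply (c *\<^sub>R \<mu>)) (s i) = c * simple_sum (sm_apply \<mu>) (s i)" for i
    by (simp add: simple_sum_def scaleR_signed_measure.rep_eq sum_distrib_left mult_ac)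
  then show ?thesis
    using signed_integral_limit[OF s, of "c *\<^sub>R \<mu>"]
      tendsto_mult_left[OF signed_integral_limit[OF s, of \<mu>], of c]
    by (simp add: LIMSEQ_unique)
qed

lemma signed_integral_diff:
  assumes "bounded_borel g"
  shows "signed_integral (\<mu> - \<nu>) g = signed_integral \<mu> g - signed_integral \<nu> g"
  using signed_integral_add[OF assms, of \<mu> "- 1 *\<^sub>R \<nu>"] signed_integral_scaleR[OF assms, of "- 1" \<nu>]
  by simp

lemma signed_integral_signed_of:
  assumes "bounded_borel g" "finite_measure p" "sets p = sets borel"
  shows "signed_integral (signed_of p) g = (LINT x|p. g x)"
proof -
  obtain s where s: "simple_approx s g"
    using simple_approx_exists[OF assms(1)] .
  have "sm_apply (signed_of p) = measure p"
    using assms(2,3) by (simp add: fun_eq_iff signed_of_apply)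
  then show ?thesis
    using signed_integral_limit[OF s, of "signed_of p"]
      simple_sum_measure_limit[OF assms(3,2) s] by (simp add: LIMSEQ_unique)
qed

text \<open>Mass of opposite sign may cancel in the image, so the Jordan parts of \<mu> need not be
  pushed to those of the image. The change of variables is made on simple sums, where it is an
  identity of level sets.\<close>

lemma signed_integral_push_forward:
  assumes g: "bounded_borel g" and F: "F \<in> borel_measurable borel"
  shows "signed_integral (push_forward F \<mu>) g = signed_integral \<mu> (\<lambda>x. g (F x))"
proof -
  obtain s where s: "simple_approx s g"
    using simple_approx_exists[OF g] .
  then have sF: "simple_approx (\<lambda>i x. s i (F x)) (\<lambda>x. g (F x))"
    unfolding simple_approx_def
  proof (intro conjI allI)
    show "finite (range (\<lambda>x. s i (F x)))" for i
      using s by (intro finite_subset[of "range (\<lambda>x. s i (F x))" "range (s i)"])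
        (auto simp: simple_approx_def)
    show "(\<lambda>x. s i (F x)) \<in> borel_measurable borel" for i
      using s F by (auto simp: simple_approx_def intro: measurable_compose)
    show "\<exists>C. \<forall>i x. \<bar>s i (F x)\<bar> \<le> C"
      using s unfolding simple_approx_def by blast
    show "(\<lambda>i. s i (F x)) \<longlonglongrightarrow> g (F x)" for x
      using s by (simp add: simple_approx_def)
  qed
  have "simple_sum (sm_apply (push_forward F \<mu>)) (s i) = simple_sum (sm_apply \<mu>) (\<lambda>x. s i (F x))" for i
  proof -
    have i: "finite (range (s i))" "s i \<in> borel_measurable borel"
      using s by (auto simp: simple_approx_def)
    \<comment> \<open>Values of s i that are never taken after F have empty level sets, so summing
      over the larger range changes nothing.\<close>
    have "simple_sum (sm_apply \<mu>) (\<lambda>x. s i (F x)) =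
        (\<Sum>y\<in>range (s i). y * sm_apply \<mu> ((\<lambda>x. s i (F x)) -` {y}))"
      unfolding simple_sum_def
    proof (rule sum.mono_neutral_left)
      have "(\<lambda>x. s i (F x)) -` {y} = {}" if "y \<notin> range (\<lambda>x. s i (F x))" for y
        using that by auto
      then show "\<forall>y\<in>range (s i) - range (\<lambda>x. s i (F x)). y * sm_apply \<mu> ((\<lambda>x. s i (F x)) -` {y}) = 0"
        by simp
    qed (use i in auto)
    moreover have "sm_apply (push_forward F \<mu>) (s i -` {y}) = sm_apply \<mu> ((\<lambda>x. s i (F x)) -` {y})" for y
      using F measurable_sets[OF i(2), of "{y}"]
      by (simp add: push_forward.rep_eq vimage_comp comp_def)
    ultimately show ?thesis
      by (simp add: simple_sum_def)
  qed
  then show ?thesis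
    using signed_integral_limit[OF s, of "push_forward F \<mu>"] signed_integral_limit[OF sF, of \<mu>]
    by (simp add: LIMSEQ_unique)
qed

text \<open>\<open>weighted\<close> is made with \<open>Abs_signed_measure\<close>, so its values
  are known only once the indefinite integral of h is shown to be countably additive. By
  disjointness |h| dominates the partial sums.\<close>

lemma weighted_apply:
  fixes p :: "'a::topological_space measure"
  assumes p: "sets p = sets borel" and h: "integrable p h"
  shows "sm_apply (weighted h p) E = (if E \<in> sets borel then (LINT x:E|p. h x) else 0)"
proof -
  have "(\<lambda>n. LINT x:A n|p. h x) sums (LINT x:(\<Union>n. A n)|p. h x)"
    if A: "range A \<subseteq> sets borel" "disjoint_family A" for A :: "nat \<Rightarrow> 'a set"
  proof -
    have ind: "(\<lambda>n. indicator (A n) x * h x) sums (indicator (\<Union>n. A n) x * h x)" for x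
      by (intro sums_mult2) (use A(2) in \<open>auto intro!: indicator_sums simp: disjoint_family_on_def\<close>)
    have "(\<lambda>n. LINT x|p. (\<Sum>i<n. indicator (A i) x * h x)) \<longlonglongrightarrow> (LINT x|p. indicator (\<Union>n. A n) x * h x)"
    proof (rule integral_dominated_convergence[where w = "\<lambda>x. \<bar>h x\<bar>"])
      show "AE x in p. (\<lambda>n. \<Sum>i<n. indicator (A i) x * h x) \<longlonglongrightarrow> indicator (\<Union>n. A n) x * h x"
        using ind by (simp add: sums_def)
      have "norm (\<Sum>i<n. indicator (A i) x * h x) \<le> \<bar>h x\<bar>" for n x
      proof -
        have "(\<Sum>i<n. indicator (A i) x :: real) = indicator (\<Union>i<n. A i) x"
          using A(2) by (subst indicator_UN_disjoint) (auto simp: disjoint_family_on_def)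
        then have "(\<Sum>i<n. indicator (A i) x * h x) = indicator (\<Union>i<n. A i) x * h x"
          by (metis sum_distrib_right)
        then show ?thesis
          by (simp only:) (simp add: indicator_def)
      qed
      then show "AE x in p. norm (\<Sum>i<n. indicator (A i) x * h x) \<le> \<bar>h x\<bar>" for n
        by simp
    qed (use A p h in \<open>auto intro!: borel_measurable_sum borel_measurable_times\<close>)
    moreover have "(LINT x|p. (\<Sum>i<n. indicator (A i) x * h x)) = (\<Sum>i<n. LINT x|p. indicator (A i) x * h x)" for n
      using A p h by (intro Bochner_Integration.integral_sum)
        (auto intro!: integrable_mult_indicator[where 'b = real, simplified real_scaleR_def])
    ultimately show ?thesis
      by (simp add: sums_def set_lebesgue_integral_def)
  qed
  then have "(\<lambda>n. if A n \<in> sets borel then (LINT x:A n|p. h x) else 0) sums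
      (if (\<Union>n. A n) \<in> sets borel then (LINT x:(\<Union>n. A n)|p. h x) else 0)"
    if "range A \<subseteq> sets borel" "disjoint_family A" for A :: "nat \<Rightarrow> 'a set"
    using that by (auto simp: image_subset_iff)
  then show ?thesis
    unfolding weighted_def by (subst Abs_signed_measure_inverse) auto
qed

text \<open>The Jordan parts of the weighted measure are never computed: both sides are limits of
  the same simple sums.\<close>

lemma signed_integral_weighted:
  assumes "bounded_borel g" "sets p = sets borel" "integrable p h"
  shows "signed_integral (weighted h p) g = (LINT x|p. g x * h x)"
proof -
  obtain s where s: "simple_approx s g"
    using simple_approx_exists[OF assms(1)] .
  have "simple_sum (sm_apply (weighted h p)) (s i) = simple_sum (\<lambda>E. LINT x:E|p. h x) (s i)" for i
    using s assms by (intro simple_sum_cong) (auto simp: weighted_apply simple_approx_def)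
  then show ?thesis
    using signed_integral_limit[OF s, of "weighted h p"]
      simple_sum_set_integral_limit[OF assms(2,3) s] by (simp add: LIMSEQ_unique)
qed

lemma signed_integral_cmult_right: "signed_integral \<mu> (\<lambda>x. c * g x) = c * signed_integral \<mu> g"
  by (simp add: signed_integral_def algebra_simps)

section \<open>Hoelder functions and disintegrations\<close>

lemma abs_le_sup_norm:
  assumes "sup_norm g \<le> ennreal B" "0 \<le> B"
  shows "\<bar>g x\<bar> \<le> B"
proof -
  have "ennreal \<bar>g x\<bar> \<le> sup_norm g"
    unfolding sup_norm_def by (rule SUP_upper) simp
  then show ?thesis
    using assms by (metis ennreal_le_iff order_trans)
qed

lemma holder_const_le_iff:
  assumes "0 \<le> H" "\<And>x y. x \<noteq> y \<Longrightarrow> 0 < d x y"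
  shows "holder_const d \<zeta> g \<le> ennreal H \<longleftrightarrow> (\<forall>x y. x \<noteq> y \<longrightarrow> \<bar>g x - g y\<bar> \<le> H * d x y powr \<zeta>)"
proof -
  have "\<bar>g x - g y\<bar> / d x y powr \<zeta> \<le> H \<longleftrightarrow> \<bar>g x - g y\<bar> \<le> H * d x y powr \<zeta>" if "x \<noteq> y" for x y
    using assms(2)[OF that] by (intro pos_divide_le_eq) simp
  then show ?thesis
    unfolding holder_const_def SUP_le_iff using assms(1) by (auto simp: ennreal_le_iff)
qed

lemma sup_norm_le_iff: "0 \<le> B \<Longrightarrow> sup_norm g \<le> ennreal B \<longleftrightarrow> (\<forall>x. \<bar>g x\<bar> \<le> B)"
  by (auto simp: sup_norm_def SUP_le_iff ennreal_le_iff)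

text \<open>\<open>W_norm\<close> tests functions whose supremum and Hoelder constant are both at
  most 1, so g / B qualifies as soon as B > 0 dominates both quantities of g.\<close>

lemma abs_signed_integral_le_W_norm:
  fixes g :: "'k::metric_space \<Rightarrow> real"
  assumes B: "0 \<le> B" "sup_norm g \<le> ennreal B" "holder_const dist \<zeta> g \<le> ennreal B"
  shows "ennreal \<bar>signed_integral \<nu> g\<bar> \<le> ennreal B * W_norm \<zeta> \<nu>"
proof (cases "B = 0")
  case True
  then have "g = (\<lambda>_. 0)"
    using abs_le_sup_norm[OF B(2,1)] by (auto simp: fun_eq_iff)
  then show ?thesis
    by (simp add: signed_integral_def)
next
  case False
  with B(1) have B0: "0 < B" by simp
  define k where "k = (\<lambda>x. (1 / B) * g x)"
  have "sup_norm k \<le> ennreal 1"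
    using B0 abs_le_sup_norm[OF B(2,1)] by (subst sup_norm_le_iff) (auto simp: k_def abs_mult)
  moreover have "holder_const dist \<zeta> k \<le> ennreal 1"
  proof -
    have "\<bar>k x - k y\<bar> \<le> 1 * dist x y powr \<zeta>" if "x \<noteq> y" for x y
    proof -
      have "\<bar>k x - k y\<bar> = \<bar>g x - g y\<bar> / B"
        using B0 by (simp add: k_def abs_divide flip: diff_divide_distrib)
      then show ?thesis
        using B0 B that by (simp add: holder_const_le_iff pos_divide_le_eq mult.commute)
    qed
    then show ?thesis
      by (subst holder_const_le_iff) auto
  qed
  ultimately have "ennreal \<bar>signed_integral \<nu> k\<bar> \<le> W_norm \<zeta> \<nu>"
    unfolding W_norm_def by (intro SUP_upper) simp
  then have "ennreal B * ennreal \<bar>signed_integral \<nu> k\<bar> \<le> ennreal B * W_norm \<zeta> \<nu>"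
    by (rule mult_left_mono) simp
  moreover have "signed_integral \<nu> k = (1 / B) * signed_integral \<nu> g"
    unfolding k_def by (rule signed_integral_cmult_right)
  ultimately show ?thesis
    using B0 by (simp add: abs_mult flip: ennreal_mult)
qed

section \<open>Disintegration of integrals along the leaves\<close>

lemma marginal_density_measurable [measurable]: "marginal_density m \<mu> \<in> borel_measurable m"
  unfolding marginal_density_def[abs_def] by measurable

lemma marginal_density_nonneg [simp]: "0 \<le> marginal_density m \<mu> \<gamma>"
  by (simp add: marginal_density_def)

lemma disintegration_emeasure:
  assumes "disintegration m \<mu> \<kappa>" "E \<in> sets borel"
  shows "emeasure \<mu> E = (\<integral>\<^sup>+\<gamma>. ennreal (marginal_density m \<mu> \<gamma> * measure (\<kappa> \<gamma>) E) \<partial>m)"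
proof -
  have meas: "(\<lambda>\<gamma>. emeasure (\<kappa> \<gamma>) E) \<in> borel_measurable m"
    using assms by (simp add: disintegration_def)
  have fin: "finite_measure (\<kappa> \<gamma>)" for \<gamma>
    using assms by (simp add: disintegration_def borel_prob_def prob_space.finite_measure)
  have "emeasure \<mu> E = (\<integral>\<^sup>+\<gamma>. emeasure (\<kappa> \<gamma>) E \<partial>density m (\<lambda>\<gamma>. ennreal (marginal_density m \<mu> \<gamma>)))"
    using assms by (simp add: disintegration_def)
  also have "\<dots> = (\<integral>\<^sup>+\<gamma>. ennreal (marginal_density m \<mu> \<gamma>) * emeasure (\<kappa> \<gamma>) E \<partial>m)"
    using meas by (intro nn_integral_density) auto
  finally show ?thesis
    using fin by (simp add: finite_measure.emeasure_eq_measure ennreal_mult)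
qed

lemma disintegration_measure_measurable:
  assumes "disintegration m \<mu> \<kappa>" "E \<in> sets borel"
  shows "(\<lambda>\<gamma>. measure (\<kappa> \<gamma>) E) \<in> borel_measurable m"
  using assms unfolding disintegration_def measure_def by (auto intro: borel_measurable_enn2real)

lemma disintegration_measure:
  assumes d: "disintegration m \<mu> \<kappa>" and \<mu>: "finite_measure \<mu>" and E: "E \<in> sets borel"
  shows "integrable m (\<lambda>\<gamma>. marginal_density m \<mu> \<gamma> * measure (\<kappa> \<gamma>) E)"
    and "(LINT \<gamma>|m. marginal_density m \<mu> \<gamma> * measure (\<kappa> \<gamma>) E) = measure \<mu> E"
proof -
  have [measurable]: "(\<lambda>\<gamma>. measure (\<kappa> \<gamma>) E) \<in> borel_measurable m"
    by (rule disintegration_measure_measurable[OF d E])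
  note em = disintegration_emeasure[OF d E]
  then show "integrable m (\<lambda>\<gamma>. marginal_density m \<mu> \<gamma> * measure (\<kappa> \<gamma>) E)"
    using finite_measure.emeasure_finite[OF \<mu>, of E]
    by (intro integrableI_nonneg) (auto simp: less_top)
  have "(LINT \<gamma>|m. marginal_density m \<mu> \<gamma> * measure (\<kappa> \<gamma>) E) =
      enn2real (\<integral>\<^sup>+\<gamma>. ennreal (marginal_density m \<mu> \<gamma> * measure (\<kappa> \<gamma>) E) \<partial>m)"
    by (intro integral_eq_nn_integral) auto
  then show "(LINT \<gamma>|m. marginal_density m \<mu> \<gamma> * measure (\<kappa> \<gamma>) E) = measure \<mu> E"
    by (simp only: em[symmetric] measure_def[of \<mu>])
qed

text \<open>A disintegration is defined by its values on sets. Simple sums carry the formula over to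
  g, with C times the marginal density as majorant.\<close>

lemma disintegration_integral:
  fixes \<mu> :: "('m::topological_space \<times> 'k::topological_space) measure"
  assumes d: "disintegration m \<mu> \<kappa>" and \<mu>: "finite_measure \<mu>" "sets \<mu> = sets borel"
    and g: "bounded_borel g"
  shows "integrable m (\<lambda>\<gamma>. marginal_density m \<mu> \<gamma> * (LINT x|\<kappa> \<gamma>. g x))"
    and "(LINT x|\<mu>. g x) = (LINT \<gamma>|m. marginal_density m \<mu> \<gamma> * (LINT x|\<kappa> \<gamma>. g x))"
proof -
  define \<phi> where "\<phi> = marginal_density m \<mu>"
  have [measurable]: "\<phi> \<in> borel_measurable m" and \<phi>0: "0 \<le> \<phi> \<gamma>" for \<gamma>
    by (simp_all add: \<phi>_def)
  have \<kappa>: "prob_space (\<kappa> \<gamma>)" "sets (\<kappa> \<gamma>) = sets borel" "space (\<kappa> \<gamma>) = UNIV" for \<gamma>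
    using d sets_eq_imp_space_eq[of "\<kappa> \<gamma>" borel]
    by (simp_all add: disintegration_def borel_prob_def)
  obtain s where s: "simple_approx s g"
    using simple_approx_exists[OF g] .
  obtain C where C: "\<And>i x. \<bar>s i x\<bar> \<le> C"
    using s by (auto simp: simple_approx_def)
  have i: "finite (range (s i))" "s i \<in> borel_measurable borel" for i
    using s by (auto simp: simple_approx_def)
  have E: "s i -` {y} \<in> sets borel" for i y
    using measurable_sets[OF i(2), of "{y}"] by simp
  define a where "a i \<gamma> = simple_sum (measure (\<kappa> \<gamma>)) (s i)" for i \<gamma>
  have [measurable]: "a i \<in> borel_measurable m" for i
    unfolding a_def[abs_def] simple_sum_def
    using disintegration_measure_measurable[OF d E] by auto
  have a_lim: "(\<lambda>i. a i \<gamma>) \<longlonglongrightarrow> (LINT x|\<kappa> \<gamma>. g x)" for \<gamma>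
    unfolding a_def by (rule simple_sum_measure_limit[OF \<kappa>(2) prob_space.finite_measure[OF \<kappa>(1)] s])
  then have [measurable]: "(\<lambda>\<gamma>. LINT x|\<kappa> \<gamma>. g x) \<in> borel_measurable m"
    by (rule borel_measurable_LIMSEQ_real) measurable
  have a_bound: "\<bar>a i \<gamma>\<bar> \<le> C" for i \<gamma>
  proof -
    interpret \<kappa>: prob_space "\<kappa> \<gamma>" by (rule \<kappa>)
    have "a i \<gamma> = (LINT x|\<kappa> \<gamma>. s i x)"
      unfolding a_def by (rule simple_sum_measure[OF \<kappa>(2) \<kappa>.finite_measure_axioms i])
    also have "\<bar>\<dots>\<bar> \<le> (LINT x|\<kappa> \<gamma>. \<bar>s i x\<bar>)"
      by (rule integral_abs_bound)
    also have "\<dots> \<le> (LINT x|\<kappa> \<gamma>. C)"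
    proof (rule integral_mono)
      have "bounded_borel (s i)"
        using i C unfolding bounded_borel_def by blast
      then show "integrable (\<kappa> \<gamma>) (\<lambda>x. \<bar>s i x\<bar>)"
        by (intro integrable_abs bounded_borel_integrable \<kappa>.finite_measure_axioms \<kappa>(2))
    qed (use C in auto)
    finally show ?thesis
      by (simp add: \<kappa>.prob_space)
  qed
  \<comment> \<open>The measures on the leaves have mass 1, so E = UNIV gives integrability of the
    marginal density itself.\<close>
  have int_\<phi>: "integrable m \<phi>"
    using disintegration_measure(1)[OF d \<mu>(1), of UNIV] prob_space.prob_space[OF \<kappa>(1)]
    by (simp add: \<phi>_def \<kappa>(3))
  have sum: "(LINT \<gamma>|m. \<phi> \<gamma> * a i \<gamma>) = simple_sum (measure \<mu>) (s i)" for i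
  proof -
    have "(LINT \<gamma>|m. \<phi> \<gamma> * a i \<gamma>) =
        (LINT \<gamma>|m. (\<Sum>y\<in>range (s i). y * (\<phi> \<gamma> * measure (\<kappa> \<gamma>) (s i -` {y}))))"
      by (simp add: a_def simple_sum_def sum_distrib_left mult_ac)
    also have "\<dots> = (\<Sum>y\<in>range (s i). LINT \<gamma>|m. y * (\<phi> \<gamma> * measure (\<kappa> \<gamma>) (s i -` {y})))"
      by (rule Bochner_Integration.integral_sum)
        (simp add: \<phi>_def disintegration_measure(1)[OF d \<mu>(1) E])
    also have "\<dots> = simple_sum (measure \<mu>) (s i)"
      by (simp add: simple_sum_def \<phi>_def disintegration_measure(2)[OF d \<mu>(1) E])
    finally show ?thesis .
  qed
  have bound: "norm (\<phi> \<gamma> * a i \<gamma>) \<le> C * \<phi> \<gamma>" for i \<gamma>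
    using mult_left_mono[OF a_bound[of i \<gamma>] \<phi>0[of \<gamma>]] \<phi>0[of \<gamma>] by (simp add: abs_mult mult.commute)
  have lim: "(\<lambda>i. \<phi> \<gamma> * a i \<gamma>) \<longlonglongrightarrow> \<phi> \<gamma> * (LINT x|\<kappa> \<gamma>. g x)" for \<gamma>
    by (intro tendsto_mult_left a_lim)
  have "integrable m (\<lambda>\<gamma>. \<phi> \<gamma> * (LINT x|\<kappa> \<gamma>. g x))"
    by (rule integrable_dominated_convergence[where w = "\<lambda>\<gamma>. C * \<phi> \<gamma>" and s = "\<lambda>i \<gamma>. \<phi> \<gamma> * a i \<gamma>"])
      (use int_\<phi> bound lim in auto)
  then show "integrable m (\<lambda>\<gamma>. marginal_density m \<mu> \<gamma> * (LINT x|\<kappa> \<gamma>. g x))"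
    by (simp add: \<phi>_def)
  have lim_sum: "(\<lambda>i. LINT \<gamma>|m. \<phi> \<gamma> * a i \<gamma>) \<longlonglongrightarrow> (LINT \<gamma>|m. \<phi> \<gamma> * (LINT x|\<kappa> \<gamma>. g x))"
    by (rule integral_dominated_convergence[where w = "\<lambda>\<gamma>. C * \<phi> \<gamma>"])
      (use int_\<phi> bound lim in auto)
  show "(LINT x|\<mu>. g x) = (LINT \<gamma>|m. marginal_density m \<mu> \<gamma> * (LINT x|\<kappa> \<gamma>. g x))"
    using LIMSEQ_unique[OF simple_sum_measure_limit[OF \<mu>(2,1) s] lim_sum[unfolded sum]]
    by (simp add: \<phi>_def)
qed

lemma measurable_snd_borel:
  fixes M :: "('m::topological_space \<times> 'k::topological_space) measure"
  assumes "sets M = sets borel"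
  shows "snd \<in> borel_measurable M"
  unfolding measurable_cong_sets[OF assms refl]
  by (intro borel_measurable_continuous_onI continuous_intros)

lemma
  fixes \<mu> :: "('m::topological_space \<times> 'k::topological_space) measure"
  assumes d: "disintegration m \<mu> \<kappa>"
  shows finite_leaf_measure: "finite_measure (leaf_measure m \<mu> \<kappa> \<gamma>)"
    and sets_leaf_measure: "sets (leaf_measure m \<mu> \<kappa> \<gamma>) = sets borel"
proof -
  have \<kappa>: "prob_space (\<kappa> \<gamma>)" "sets (\<kappa> \<gamma>) = sets borel"
    using d by (simp_all add: disintegration_def borel_prob_def)
  have "finite_measure (scale_measure (ennreal (marginal_density m \<mu> \<gamma>)) (\<kappa> \<gamma>))"
    using prob_space.emeasure_space_1[OF \<kappa>(1)]
    by (intro finite_measureI) (simp add: space_scale_measure)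
  then show "finite_measure (leaf_measure m \<mu> \<kappa> \<gamma>)"
    unfolding leaf_measure_def
    by (rule finite_measure.finite_measure_distr)
      (use \<kappa>(2) in \<open>auto intro: measurable_snd_borel\<close>)
  show "sets (leaf_measure m \<mu> \<kappa> \<gamma>) = sets borel"
    by (simp add: leaf_measure_def)
qed

lemma integral_scale_measure_real:
  fixes g :: "'a \<Rightarrow> real"
  assumes "0 \<le> c" and g: "integrable M g"
  shows "(LINT x|scale_measure (ennreal c) M. g x) = c * (LINT x|M. g x)"
proof -
  have "integrable (scale_measure (ennreal c) M) g"
    using g by (auto simp: integrable_iff_bounded nn_integral_scale_measure ennreal_mult_less_top)
  then show ?thesis
    using assms by (simp add: real_lebesgue_integral_def nn_integral_scale_measure enn2real_mult
        algebra_simps)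
qed

text \<open>\<open>\<kappa> \<gamma>\<close> is carried by the leaf over \<gamma>, so replacing the
  first coordinate by \<gamma> changes g only on a null set; after that g depends on
  \<open>snd\<close> alone and the push-forward to the fiber applies.\<close>

lemma integral_leaf_measure:
  fixes \<mu> :: "('m::{metric_space, second_countable_topology} \<times> 'k::{metric_space, second_countable_topology}) measure"
  assumes d: "disintegration m \<mu> \<kappa>" and g: "bounded_borel g"
  shows "(LINT z|leaf_measure m \<mu> \<kappa> \<gamma>. g (\<gamma>, z)) = marginal_density m \<mu> \<gamma> * (LINT x|\<kappa> \<gamma>. g x)"
proof -
  have \<kappa>: "prob_space (\<kappa> \<gamma>)" "sets (\<kappa> \<gamma>) = sets borel" "emeasure (\<kappa> \<gamma>) ({\<gamma>} \<times> UNIV) = 1"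
    using d by (simp_all add: disintegration_def borel_prob_def)
  interpret \<kappa>: prob_space "\<kappa> \<gamma>" by (rule \<kappa>)
  have bb: "bounded_borel (\<lambda>x :: 'm \<times> 'k. g (\<gamma>, snd x))" "bounded_borel (\<lambda>z. g (\<gamma>, z))"
    by (rule bounded_borel_compose[OF g], intro borel_measurable_continuous_onI continuous_intros)+
  then have [measurable]: "(\<lambda>x. g (\<gamma>, snd x)) \<in> borel_measurable (\<kappa> \<gamma>)" "g \<in> borel_measurable (\<kappa> \<gamma>)"
    "(\<lambda>z. g (\<gamma>, z)) \<in> borel_measurable borel"
    using g unfolding bounded_borel_def measurable_cong_sets[OF \<kappa>(2) refl] by auto
  have int: "integrable (\<kappa> \<gamma>) (\<lambda>x. g (\<gamma>, snd x))"
    by (rule bounded_borel_integrable[OF bb(1) \<kappa>.finite_measure_axioms \<kappa>(2)])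
  have "(LINT z|leaf_measure m \<mu> \<kappa> \<gamma>. g (\<gamma>, z)) =
      (LINT x|scale_measure (ennreal (marginal_density m \<mu> \<gamma>)) (\<kappa> \<gamma>). g (\<gamma>, snd x))"
    unfolding leaf_measure_def
    using \<kappa>(2) by (intro integral_distr measurable_snd_borel) simp_all
  also have "\<dots> = marginal_density m \<mu> \<gamma> * (LINT x|\<kappa> \<gamma>. g (\<gamma>, snd x))"
    by (rule integral_scale_measure_real[OF _ int]) simp
  also have "(LINT x|\<kappa> \<gamma>. g (\<gamma>, snd x)) = (LINT x|\<kappa> \<gamma>. g x)"
  proof (rule integral_cong_AE)
    have "AE x in \<kappa> \<gamma>. x \<in> {\<gamma>} \<times> UNIV"
      using \<kappa>(3) by (intro \<kappa>.AE_prob_1) (simp add: measure_def)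
    then show "AE x in \<kappa> \<gamma>. g (\<gamma>, snd x) = g x"
      by eventually_elim auto
  qed measurable
  finally show ?thesis .
qed

text \<open>On almost every leaf the integral of the slice is at most B times the essential supremum
  of the fiber norms, and integrating over the probability m adds no factor. Each leaf sees only its
  own slice, so the Hoelder bound is asked of slices alone.\<close>

lemma abs_signed_integral_le_Linf_norm:
  fixes g :: "'m::{metric_space, second_countable_topology} \<times> 'k::{metric_space, second_countable_topology} \<Rightarrow> real"
  assumes m: "prob_space m" and g: "bounded_borel g" and B: "0 \<le> B" "\<And>x. \<bar>g x\<bar> \<le> B"
    and H: "\<And>\<gamma>. holder_const dist \<zeta> (\<lambda>z. g (\<gamma>, z)) \<le> ennreal B"
  shows "ennreal \<bar>signed_integral \<mu> g\<bar> \<le> ennreal B * Linf_norm \<zeta> m \<mu>"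
proof (cases "B = 0")
  case True
  then have "g = (\<lambda>_. 0)"
    using B by (auto simp: fun_eq_iff)
  then show ?thesis
    by (simp add: signed_integral_def)
next
  case False
  with B(1) have B0: "0 < B" by simp
  interpret prob_space m by (rule m)
  have slice: "bounded_borel (\<lambda>z. g (\<gamma>, z))" for \<gamma>
    by (rule bounded_borel_compose[OF g]) (intro borel_measurable_continuous_onI continuous_intros)
  have sup: "sup_norm (\<lambda>z. g (\<gamma>, z)) \<le> ennreal B" for \<gamma>
    using B by (simp add: sup_norm_le_iff)
  have main: "ennreal \<bar>signed_integral \<mu> g\<bar> \<le>
      ennreal B * esssup m (\<lambda>\<gamma>. W_norm \<zeta> (leaf_restriction m \<mu> \<kappa> \<kappa>' \<gamma>))"
    if d: "disintegration m (pos_part \<mu>) \<kappa>" "disintegration m (neg_part \<mu>) \<kappa>'" for \<kappa> \<kappa>'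
  proof -
    let ?r = "leaf_restriction m \<mu> \<kappa> \<kappa>'"
    have leaf: "signed_integral (?r \<gamma>) (\<lambda>z. g (\<gamma>, z)) =
        marginal_density m (pos_part \<mu>) \<gamma> * (LINT x|\<kappa> \<gamma>. g x) -
        marginal_density m (neg_part \<mu>) \<gamma> * (LINT x|\<kappa>' \<gamma>. g x)" for \<gamma>
      unfolding leaf_restriction_def
      by (simp add: signed_integral_diff signed_integral_signed_of slice d finite_leaf_measure
          sets_leaf_measure integral_leaf_measure g)
    note pos = disintegration_integral[OF d(1) finite_pos_part sets_pos_part g]
    note neg = disintegration_integral[OF d(2) finite_neg_part sets_neg_part g]
    have int: "integrable m (\<lambda>\<gamma>. signed_integral (?r \<gamma>) (\<lambda>z. g (\<gamma>, z)))"
      unfolding leaf using pos(1) neg(1) by simp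
    have "signed_integral \<mu> g = (LINT \<gamma>|m. signed_integral (?r \<gamma>) (\<lambda>z. g (\<gamma>, z)))"
      unfolding leaf signed_integral_def[of \<mu>] using pos neg by simp
    then have "ennreal \<bar>signed_integral \<mu> g\<bar> \<le>
        (\<integral>\<^sup>+\<gamma>. ennreal \<bar>signed_integral (?r \<gamma>) (\<lambda>z. g (\<gamma>, z))\<bar> \<partial>m)"
      using integral_norm_bound_ennreal[OF int] by simp
    also have "\<dots> \<le> (\<integral>\<^sup>+\<gamma>. ennreal B * esssup m (\<lambda>\<gamma>. W_norm \<zeta> (?r \<gamma>)) \<partial>m)"
    proof (rule nn_integral_mono_AE)
      show "AE \<gamma> in m. ennreal \<bar>signed_integral (?r \<gamma>) (\<lambda>z. g (\<gamma>, z))\<bar> \<le>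
          ennreal B * esssup m (\<lambda>\<gamma>. W_norm \<zeta> (?r \<gamma>))"
        using esssup_AE[of "\<lambda>\<gamma>. W_norm \<zeta> (?r \<gamma>)" m]
      proof eventually_elim
        case (elim \<gamma>)
        show ?case
          using abs_signed_integral_le_W_norm[OF B(1) sup H] mult_left_mono[OF elim, of "ennreal B"]
          by (meson order_trans zero_le)
      qed
    qed
    also have "\<dots> = ennreal B * esssup m (\<lambda>\<gamma>. W_norm \<zeta> (?r \<gamma>))"
      by (simp add: emeasure_space_1)
    finally show ?thesis .
  qed
  \<comment> \<open>In divided form the estimate is a lower bound for each member of the family and
    passes to the infimum in \<open>Linf_norm\<close>, even when no disintegration exists and the
    infimum is infinite.\<close>
  have div: "ennreal (\<bar>signed_integral \<mu> g\<bar> / B) \<le> x" if "ennreal \<bar>signed_integral \<mu> g\<bar> \<le> ennreal B * x" for x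
  proof (cases x)
    case (real r)
    then show ?thesis
      using that B0 by (simp add: ennreal_le_iff divide_le_eq mult.commute flip: ennreal_mult)
  qed simp
  have "ennreal (\<bar>signed_integral \<mu> g\<bar> / B) \<le> Linf_norm \<zeta> m \<mu>"
    unfolding Linf_norm_def by (rule INF_greatest) (use main div in auto)
  then have "ennreal B * ennreal (\<bar>signed_integral \<mu> g\<bar> / B) \<le> ennreal B * Linf_norm \<zeta> m \<mu>"
    by (rule mult_left_mono) simp
  then show ?thesis
    using B0 by (simp flip: ennreal_mult)
qed

text \<open>All values are compared with the one at a fixed point, here \<open>undefined\<close>; a
  bounded distance bounds the deviation from it.\<close>

lemma sup_norm_holder_finite:
  assumes d: "\<And>x y. x \<noteq> y \<Longrightarrow> 0 < d x y" "\<And>x y. d x y \<le> D" and "0 \<le> \<zeta>"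
    and g: "holder_const d \<zeta> g < \<infinity>"
  shows "sup_norm g < \<infinity>"
proof -
  obtain H where H: "0 \<le> H" "holder_const d \<zeta> g = ennreal H"
    using g by (cases "holder_const d \<zeta> g") auto
  have g_le: "\<bar>g x - g y\<bar> \<le> H * d x y powr \<zeta>" if "x \<noteq> y" for x y
    using holder_const_le_iff[of H d \<zeta> g] d(1) H that by simp
  have "\<bar>g x\<bar> \<le> \<bar>g undefined\<bar> + H * \<bar>D\<bar> powr \<zeta>" for x
  proof (cases "x = undefined")
    case False
    have "d x undefined powr \<zeta> \<le> \<bar>D\<bar> powr \<zeta>"
      using d(1)[OF False] d(2)[of x undefined] \<open>0 \<le> \<zeta>\<close> by (intro powr_mono2) auto
    then show ?thesis
      using g_le[OF False] mult_left_mono[OF _ H(1)] by fastforce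
  qed (use H in simp)
  then have "sup_norm g \<le> ennreal (\<bar>g undefined\<bar> + H * \<bar>D\<bar> powr \<zeta>)"
    using H(1) by (subst sup_norm_le_iff) auto
  then show ?thesis
    using le_less_trans[OF _ ennreal_less_top] by simp
qed

lemma compact_dist_bounded:
  assumes "compact (UNIV :: 'a::metric_space set)"
  obtains D where "\<And>x y :: 'a. dist x y \<le> D"
  using compact_imp_bounded[OF assms] bounded_two_points[of "UNIV :: 'a set"] by auto

text \<open>For the density, membership in \<open>Sinf\<close> bounds only the Hoelder constant of a
  version; compactness of M supplies the supremum. Finiteness turns the geometric bound on N into
  convergence to 0.\<close>

lemma Sinf_norm_finite:
  fixes \<mu> :: "('m::metric_space \<times> 'k::metric_space) signed_measure"
  assumes M: "compact (UNIV :: 'm set)" and "0 \<le> \<zeta>" and \<mu>: "\<mu> \<in> Sinf \<zeta> m"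
  shows "Sinf_norm \<zeta> m \<mu> < \<infinity>"
proof -
  obtain D where D: "\<And>x y :: 'm. dist x y \<le> D"
    using compact_dist_bounded[OF M] by blast
  obtain \<phi> where \<phi>: "\<phi> \<in> holder_versions \<zeta> m \<mu>"
    using \<mu> by (auto simp: Sinf_def)
  then have "holder_const dist \<zeta> \<phi> < \<infinity>"
    by (simp add: holder_versions_def holder_functions_def)
  moreover from this have "sup_norm \<phi> < \<infinity>"
    using D \<open>0 \<le> \<zeta>\<close> by (intro sup_norm_holder_finite[where d = dist]) auto
  ultimately have "holder_norm dist \<zeta> \<phi> < \<infinity>"
    by (simp add: holder_norm_def)
  then have "(INF \<phi>\<in>holder_versions \<zeta> m \<mu>. holder_norm dist \<zeta> \<phi>) < \<infinity>"
    using INF_lower[OF \<phi>] by (rule le_less_trans[rotated])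
  then show ?thesis
    using \<mu> by (simp add: Sinf_norm_def Sinf_def Linf_def)
qed

lemma Linf_norm_le_Sinf_norm: "Linf_norm \<zeta> m \<mu> \<le> Sinf_norm \<zeta> m \<mu>"
  by (simp add: Sinf_norm_def)

section \<open>Hoelder functions for the sum metric\<close>

lemma sum_dist_pos: "p \<noteq> q \<Longrightarrow> 0 < sum_dist p q"
  by (cases p; cases q) (auto simp: sum_dist_def add_pos_nonneg add_nonneg_pos)

text \<open>The topology of the product type comes from the Euclidean product metric, so continuity
  is derived from \<open>sum_dist q p\<close> tending to 0 as q tends to p. It provides the Borel
  measurability of g.\<close>

lemma continuous_on_holder_sum_dist:
  fixes g :: "'m::metric_space \<times> 'k::metric_space \<Rightarrow> real"
  assumes "0 < \<zeta>" and g: "g \<in> holder_functions sum_dist \<zeta>"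
  shows "continuous_on UNIV g"
proof -
  obtain H where H: "0 \<le> H" "holder_const sum_dist \<zeta> g = ennreal H"
    using g by (cases "holder_const sum_dist \<zeta> g") (auto simp: holder_functions_def)
  have "holder_const sum_dist \<zeta> g \<le> ennreal H"
    using H(2) by simp
  with H(1) sum_dist_pos have "\<forall>p q. p \<noteq> q \<longrightarrow> \<bar>g p - g q\<bar> \<le> H * sum_dist p q powr \<zeta>"
    by (rule holder_const_le_iff[THEN iffD1])
  then have g_le: "\<bar>g q - g p\<bar> \<le> H * sum_dist q p powr \<zeta>" for p q
    using H(1) by (cases "q = p") (simp, blast)
  have "(g \<longlongrightarrow> g p) (at p)" for p
  proof (rule LIM_zero_cancel, rule tendsto_0_le[where K = 1])
    have "((\<lambda>q. sum_dist q p) \<longlongrightarrow> sum_dist p p) (at p)"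
      unfolding sum_dist_def by (intro tendsto_intros)
    then have "((\<lambda>q. sum_dist q p powr \<zeta>) \<longlongrightarrow> sum_dist p p powr \<zeta>) (at p)"
      by (rule tendsto_powr'[OF _ tendsto_const]) (use \<open>0 < \<zeta>\<close> in \<open>auto simp: sum_dist_def\<close>)
    then show "((\<lambda>q. H * sum_dist q p powr \<zeta>) \<longlongrightarrow> 0) (at p)"
      by (intro tendsto_mult_right_zero) (simp add: sum_dist_def)
    show "\<forall>\<^sub>F q in at p. norm (g q - g p) \<le> norm (H * sum_dist q p powr \<zeta>) * 1"
      using g_le H(1) by (intro always_eventually) (simp add: abs_mult)
  qed
  then show ?thesis
    by (simp add: continuous_on_eq_continuous_at continuous_at)
qed

text \<open>Within one leaf the sum metric is the distance of the fiber, so the pairs of a slice are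
  among those of the product.\<close>

lemma holder_const_slice_le:
  fixes g :: "'m::metric_space \<times> 'k::metric_space \<Rightarrow> real"
  shows "holder_const dist \<zeta> (\<lambda>z. g (\<gamma>, z)) \<le> holder_const sum_dist \<zeta> g"
  unfolding holder_const_def
proof (rule SUP_mono)
  fix zz :: "'k \<times> 'k" assume "zz \<in> {(x, y). x \<noteq> y}"
  then show "\<exists>pq\<in>{(p, q). p \<noteq> q}. (case zz of (x, y) \<Rightarrow> ennreal (\<bar>g (\<gamma>, x) - g (\<gamma>, y)\<bar> / dist x y powr \<zeta>))
      \<le> (case pq of (p, q) \<Rightarrow> ennreal (\<bar>g p - g q\<bar> / sum_dist p q powr \<zeta>))"
    by (intro bexI[of _ "((\<gamma>, fst zz), (\<gamma>, snd zz))"]) (auto simp: sum_dist_def)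
qed

text \<open>The choice B = \<open>holder_norm sum_dist \<zeta> g\<close> meets both requirements on
  B at once; this is the origin of the factor |g| in the final bound.\<close>

lemma abs_signed_integral_le_holder_norm:
  fixes g :: "'m::{metric_space, second_countable_topology} \<times> 'k::{metric_space, second_countable_topology} \<Rightarrow> real"
  assumes m: "prob_space m" and M: "compact (UNIV :: 'm set)" and K: "compact (UNIV :: 'k set)"
    and \<zeta>: "0 < \<zeta>" and g: "g \<in> holder_functions sum_dist \<zeta>"
  shows "bounded_borel g" and "holder_norm sum_dist \<zeta> g < \<infinity>"
    and "ennreal \<bar>signed_integral \<mu> g\<bar> \<le> holder_norm sum_dist \<zeta> g * Linf_norm \<zeta> m \<mu>"
proof -
  obtain D where D: "\<And>x y :: 'm. dist x y \<le> D"
    using compact_dist_bounded[OF M] by blast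
  obtain D' where D': "\<And>x y :: 'k. dist x y \<le> D'"
    using compact_dist_bounded[OF K] by blast
  have H: "holder_const sum_dist \<zeta> g < \<infinity>"
    using g by (simp add: holder_functions_def)
  have S: "sup_norm g < \<infinity>"
    using sum_dist_pos add_mono[OF D D'] \<zeta> H
    by (intro sup_norm_holder_finite[where d = sum_dist]) (auto simp: sum_dist_def)
  then obtain s where s: "0 \<le> s" "sup_norm g = ennreal s"
    by (cases "sup_norm g") auto
  with g \<zeta> show bb: "bounded_borel g"
    unfolding bounded_borel_def
    using borel_measurable_continuous_onI[OF continuous_on_holder_sum_dist] abs_le_sup_norm[of g s]
    by auto
  show norm: "holder_norm sum_dist \<zeta> g < \<infinity>"
    using H S by (simp add: holder_norm_def)
  then obtain B where B: "0 \<le> B" "holder_norm sum_dist \<zeta> g = ennreal B"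
    by (cases "holder_norm sum_dist \<zeta> g") auto
  have le: "sup_norm g \<le> ennreal B" "holder_const sum_dist \<zeta> g \<le> ennreal B"
    unfolding B(2)[symmetric] holder_norm_def by simp_all
  show "ennreal \<bar>signed_integral \<mu> g\<bar> \<le> holder_norm sum_dist \<zeta> g * Linf_norm \<zeta> m \<mu>"
    unfolding B(2)
    by (rule abs_signed_integral_le_Linf_norm[OF m bb B(1) abs_le_sup_norm[OF le(1) B(1)]
          order_trans[OF holder_const_slice_le le(2)]])
qed

section \<open>Spectral decomposition and decay of correlations\<close>

lemma push_forward_add: "push_forward F (\<mu> + \<nu>) = push_forward F \<mu> + push_forward F \<nu>"
  by transfer (simp add: fun_eq_iff)

lemma push_forward_invariant:
  assumes "invariant_prob F p" and F: "F \<in> borel_measurable borel"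
  shows "push_forward F (signed_of p) = signed_of p"
proof -
  have p: "prob_space p" "sets p = sets borel" "distr p borel F = p"
    using assms(1) by (simp_all add: invariant_prob_def borel_prob_def)
  have "sm_apply (push_forward F (signed_of p)) E = sm_apply (signed_of p) E" for E
  proof (cases "E \<in> sets borel")
    case True
    have "measure (distr p borel F) E = measure p (F -` E)"
      using True F p(2) sets_eq_imp_space_eq[OF p(2)]
      by (subst measure_distr) (auto simp: measurable_cong_sets[OF p(2) refl])
    then show ?thesis
      using True F p by (simp add: push_forward.rep_eq signed_of_apply prob_space.finite_measure)
  qed (simp add: sm_apply_notin)
  then show ?thesis
    by (simp add: fun_eq_iff flip: sm_apply_inject)
qed

lemma signed_integral_push_forward_funpow:
  fixes F :: "'a::topological_space \<Rightarrow> 'a"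
  assumes "bounded_borel g" and F: "F \<in> borel_measurable borel"
  shows "signed_integral ((push_forward F ^^ n) \<mu>) g = signed_integral \<mu> (\<lambda>x. g ((F ^^ n) x))"
  using assms(1)
\<comment> \<open>Each step replaces g by its composition with F, hence the generalisation over
  g.\<close>
proof (induction n arbitrary: g)
  case (Suc n)
  have "bounded_borel (\<lambda>x. g (F x))"
    by (rule bounded_borel_compose[OF Suc.prems F])
  then show ?case
    using Suc.IH by (simp add: signed_integral_push_forward[OF Suc.prems F])
qed simp

lemma measurable_funpow_borel:
  fixes F :: "'a::topological_space \<Rightarrow> 'a"
  shows "F \<in> borel_measurable borel \<Longrightarrow> F ^^ n \<in> borel_measurable borel"
  by (induction n) (auto intro: measurable_comp)

lemma continuous_on_local_diffeomorphism:
  fixes f :: "'m::t2_space \<Rightarrow> 'm"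
  assumes "local_diffeomorphism atlas f"
  shows "continuous_on UNIV f"
proof -
  have "isCont f x" for x
  proof -
    obtain U where U: "open U" "x \<in> U" "C1_map_on atlas U f"
      using assms unfolding local_diffeomorphism_def by blast
    then have "continuous_on U f"
      by (simp add: C1_map_on_def)
    then show ?thesis
      using continuous_on_eq_continuous_at[OF U(1), of f] U(2) by blast
  qed
  then show ?thesis
    by (simp add: continuous_on_eq_continuous_at)
qed

text \<open>For a map that is not Borel, \<open>push_forward\<close> would take its default value 0.
  Second countability makes a pair of Borel maps Borel into the product.\<close>

lemma skew_product_measurable:
  fixes G :: "'m::second_countable_topology \<times> 'k::second_countable_topology \<Rightarrow> 'k"
  assumes "continuous_on UNIV f" and G: "G \<in> borel_measurable borel"
  shows "skew_product f G \<in> borel_measurable borel"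
proof -
  have "(\<lambda>p :: 'm \<times> 'k. f (fst p)) \<in> borel_measurable borel"
    by (intro borel_measurable_continuous_onI continuous_on_compose2[OF assms(1)] continuous_intros) simp
  moreover have "skew_product f G = (\<lambda>p. (f (fst p), G p))"
    by (auto simp: skew_product_def fun_eq_iff)
  ultimately show ?thesis
    using G by (simp add: borel_measurable_Pair)
qed

text \<open>T fixes P u because NP = 0, and acts as N on images of N because PN = 0, so no cross
  terms arise. The exponent starts at 1: for exponent 0 the formula would read u = P u + u.\<close>

lemma funpow_projection_plus:
  fixes T :: "'v::real_vector \<Rightarrow> 'v"
  assumes T_add: "\<And>u v. T (u + v) = T u + T v"
    and P: "P ` S \<subseteq> S" and N: "N ` S \<subseteq> S"
    and T: "\<And>u. u \<in> S \<Longrightarrow> T u = P u + N u"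
    and PP: "\<And>u. u \<in> S \<Longrightarrow> P (P u) = P u"
    and PN: "\<And>u. u \<in> S \<Longrightarrow> P (N u) = 0" and NP: "\<And>u. u \<in> S \<Longrightarrow> N (P u) = 0"
    and u: "u \<in> S"
  shows "(T ^^ Suc n) u = P u + (N ^^ Suc n) u"
proof (induction n)
  case 0
  show ?case using T[OF u] by simp
next
  case (Suc n)
  have Nn: "(N ^^ k) u \<in> S" for k
    by (induction k) (use N u in auto)
  have "(T ^^ Suc (Suc n)) u = T (P u) + T ((N ^^ Suc n) u)"
    using Suc by (simp add: T_add)
  also have "T (P u) = P u"
    using T[of "P u"] P u PP[OF u] NP[OF u] by auto
  also have "T ((N ^^ Suc n) u) = (N ^^ Suc (Suc n)) u"
    using T[OF Nn[of "Suc n"]] PN[OF Nn[of n]] by simp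
  finally show ?case .
qed

text \<open>On a line, a homogeneous functional with l e = 1 reads off the coefficient of e. In the
  application l is the total mass.\<close>

lemma rank_one_eq:
  fixes V :: "'v::real_vector set"
  assumes "dim V = 1" "e \<in> V" "v \<in> V"
    and l: "\<And>c u. l (c *\<^sub>R u) = c * l u" and "l e = 1"
  shows "v = l v *\<^sub>R e"
proof -
  obtain B where B: "V \<subseteq> span B" "card B = 1"
    using basis_exists[of V] assms(1) by metis
  then obtain b where b: "B = {b}"
    by (metis card_1_singletonE)
  obtain a c where a: "e = a *\<^sub>R b" and c: "v = c *\<^sub>R b"
    using assms(2,3) B(1) unfolding b span_singleton by blast
  have "a * l b = 1"
    using assms(5) l a by simp
  then have "b = l b *\<^sub>R e"
    by (simp add: a mult.commute)
  then show ?thesis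
    using l c by (metis scaleR_scaleR)
qed

theorem theorem3:
  fixes atlas :: "('m::{metric_space, second_countable_topology}, 'e::euclidean_space) chart set"
    and metric :: "('m, 'e) metric_tensor"
    and f :: "'m \<Rightarrow> 'm"
    and lip :: "'m \<Rightarrow> real"
    and A :: "'m set"
    and \<zeta> \<sigma> L \<epsilon> \<alpha> \<xi> K0 :: real
    and q :: nat
    and m1 :: "'m measure"
    and J \<rho> :: "'m \<Rightarrow> real"
    and G :: "'m \<times> 'k::{metric_space, second_countable_topology} \<Rightarrow> 'k"
    and F :: "'m \<times> 'k \<Rightarrow> 'm \<times> 'k"
    and \<mu>0 :: "('m \<times> 'k) measure"
    and P N :: "('m \<times> 'k) signed_measure \<Rightarrow> ('m \<times> 'k) signed_measure"
    and g h :: "'m \<times> 'k \<Rightarrow> real"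
    and n :: nat
  assumes zeta: "0 < \<zeta>" "\<zeta> < 1"
    and M: "compact (UNIV :: 'm set)" "connected (UNIV :: 'm set)"
      "riemannian_manifold atlas metric" "diameter (UNIV :: 'm set) = 1"
    and f: "local_diffeomorphism atlas f"
    and lip_cont: "continuous_on UNIV lip"
    and lip: "\<And>x. \<exists>U. open U \<and> x \<in> U \<and> inj_on f U \<and>
      (\<forall>y\<in>f ` U. \<forall>z\<in>f ` U. dist (inv_into U f y) (inv_into U f z) \<le> lip x * dist y z)"
    and params: "open A" "1 < \<sigma>" "1 \<le> L" "0 < \<epsilon>" "q < map_degree f"
    and f1: "\<And>x. x \<in> A \<Longrightarrow> lip x \<le> L" "\<And>x. x \<notin> A \<Longrightarrow> lip x < inverse \<sigma>"
    and f2: "\<exists>\<U>. finite \<U> \<and> (\<forall>U\<in>\<U>. open U \<and> inj_on f U) \<and> \<Union>\<U> = UNIV \<and>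
      (\<exists>\<V>\<subseteq>\<U>. card \<V> = q \<and> A \<subseteq> \<Union>\<V>)"
    and m1: "max_entropy_prob f m1" "\<exists>\<nu>. conformal_prob f \<nu> \<and> absolutely_continuous \<nu> m1"
    and J: "is_jacobian f m1 J"
    and rho: "\<rho> = (\<lambda>x. 1 / J x)"
    and f3: "(SUP x. ln (\<rho> x)) - (INF x. ln (\<rho> x)) < \<epsilon>"
      "holder_const dist \<zeta> \<rho> < ennreal (\<epsilon> * (INF x. \<rho> x))"
    and contraction: "exp \<epsilon> *
      (((real (map_degree f) - real q) * \<sigma> powr (- \<zeta>)
         + real q * L powr \<zeta> * (1 + (L - 1) powr \<zeta>)) / real (map_degree f)) < 1"
    and K: "compact (UNIV :: 'k set)"
    and G: "G \<in> borel_measurable borel"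
    and alpha: "0 < \<alpha>" "\<alpha> < 1"
    and G1: "AE x in m1. \<forall>z1 z2. dist (G (x, z1)) (G (x, z2)) \<le> \<alpha> * dist z1 z2"
    and F: "F = skew_product f G"
    and mu0: "invariant_prob F \<mu>0" "signed_of \<mu>0 \<in> Sinf \<zeta> m1"
    and mu0_unique: "\<And>\<nu>. invariant_prob F \<nu> \<Longrightarrow> signed_of \<nu> \<in> Sinf \<zeta> m1 \<Longrightarrow> \<nu> = \<mu>0"
    and P: "linear_operator_on (Sinf \<zeta> m1) P"
    and N: "linear_operator_on (Sinf \<zeta> m1) N"
    and decomposition: "\<And>\<mu>. \<mu> \<in> Sinf \<zeta> m1 \<Longrightarrow> push_forward F \<mu> = P \<mu> + N \<mu>"
    and P_idem: "\<And>\<mu>. \<mu> \<in> Sinf \<zeta> m1 \<Longrightarrow> P (P \<mu>) = P \<mu>"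
    and P_dim: "dim (P ` Sinf \<zeta> m1) = 1"
    and PN: "\<And>\<mu>. \<mu> \<in> Sinf \<zeta> m1 \<Longrightarrow> P (N \<mu>) = 0" "\<And>\<mu>. \<mu> \<in> Sinf \<zeta> m1 \<Longrightarrow> N (P \<mu>) = 0"
    and xi: "0 < \<xi>" "\<xi> < 1"
    and K0: "0 < K0"
    and N_bound: "\<And>\<mu> n. \<mu> \<in> Sinf \<zeta> m1 \<Longrightarrow> 1 \<le> n \<Longrightarrow>
      Sinf_norm \<zeta> m1 ((N ^^ n) \<mu>) \<le> ennreal (K0 * \<xi> ^ n) * Sinf_norm \<zeta> m1 \<mu>"
    and g: "g \<in> holder_functions sum_dist \<zeta>"
    and h: "h \<in> Theta \<zeta> m1 \<mu>0"
    and n: "1 \<le> n"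
  shows "ennreal \<bar>(LINT p|\<mu>0. g ((F ^^ n) p) * h p) - (LINT p|\<mu>0. g p) * (LINT p|\<mu>0. h p)\<bar>
    \<le> Sinf_norm \<zeta> m1 (weighted h \<mu>0) * ennreal K0 * holder_norm sum_dist \<zeta> g * ennreal (\<xi> ^ n)"
proof -
  let ?S = "Sinf \<zeta> m1 :: ('m \<times> 'k) signed_measure set"
  let ?I = "signed_integral :: ('m \<times> 'k) signed_measure \<Rightarrow> ('m \<times> 'k \<Rightarrow> real) \<Rightarrow> real"
  let ?T = "push_forward F"
  have F_meas: "F \<in> borel_measurable borel"
    unfolding F by (intro skew_product_measurable continuous_on_local_diffeomorphism[OF f] G)
  have m1_prob: "prob_space m1"
    using m1 by (simp add: max_entropy_prob_def invariant_prob_def borel_prob_def)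
  have \<mu>0: "prob_space \<mu>0" "sets \<mu>0 = sets borel"
    using mu0 by (simp_all add: invariant_prob_def borel_prob_def)
  note \<mu>0_fin = prob_space.finite_measure[OF \<mu>0(1)]
  note holder = abs_signed_integral_le_holder_norm[OF m1_prob M(1) K zeta(1)]
  have PS: "P ` ?S \<subseteq> ?S" and NS: "N ` ?S \<subseteq> ?S"
    using P N by (simp_all add: linear_operator_on_def)
  have iter: "(?T ^^ n) u = P u + (N ^^ n) u" if "u \<in> ?S" "1 \<le> n" for u n
    using funpow_projection_plus[OF push_forward_add PS NS decomposition P_idem PN that(1), of "n - 1"]
      that(2) by simp
  \<comment> \<open>This is already the bound of the theorem, for arbitrary u and k: the integral is
    controlled by \<open>Linf_norm\<close>, one summand of the norm in
    \<open>N_bound\<close>.\<close>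
  have N_le: "ennreal \<bar>?I ((N ^^ n) u) k\<bar> \<le>
      Sinf_norm \<zeta> m1 u * ennreal K0 * holder_norm sum_dist \<zeta> k * ennreal (\<xi> ^ n)"
    if u: "u \<in> ?S" and k: "k \<in> holder_functions sum_dist \<zeta>" and n: "1 \<le> n" for u k n
  proof -
    have "ennreal \<bar>?I ((N ^^ n) u) k\<bar> \<le> holder_norm sum_dist \<zeta> k * Linf_norm \<zeta> m1 ((N ^^ n) u)"
      by (rule holder(3)[OF k])
    also have "\<dots> \<le> holder_norm sum_dist \<zeta> k * (ennreal (K0 * \<xi> ^ n) * Sinf_norm \<zeta> m1 u)"
      by (intro mult_left_mono order_trans[OF Linf_norm_le_Sinf_norm N_bound[OF u n]]) simp
    finally show ?thesis
      using K0 xi by (simp add: ennreal_mult mult_ac)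
  qed
  have N_lim: "(\<lambda>n. ?I ((N ^^ n) u) k) \<longlonglongrightarrow> 0"
    if u: "u \<in> ?S" and k: "k \<in> holder_functions sum_dist \<zeta>" for u k
  proof -
    obtain R where R: "0 \<le> R" "Sinf_norm \<zeta> m1 u = ennreal R"
      using Sinf_norm_finite[OF M(1) _ u] zeta by (cases "Sinf_norm \<zeta> m1 u") auto
    obtain B where B: "0 \<le> B" "holder_norm sum_dist \<zeta> k = ennreal B"
      using holder(2)[OF k] by (cases "holder_norm sum_dist \<zeta> k") auto
    have "\<bar>?I ((N ^^ n) u) k\<bar> \<le> R * K0 * B * \<xi> ^ n" if "1 \<le> n" for n
      using N_le[OF u k that] R B K0 xi by (simp add: ennreal_le_iff flip: ennreal_mult)
    then have "\<forall>\<^sub>F n in sequentially. norm (?I ((N ^^ n) u) k) \<le> R * K0 * B * \<xi> ^ n"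
      by (intro eventually_sequentiallyI[of 1]) simp
    moreover have "(\<lambda>n. R * K0 * B * \<xi> ^ n) \<longlonglongrightarrow> 0"
      using xi by (intro tendsto_mult_right_zero LIMSEQ_realpow_zero) auto
    ultimately show ?thesis
      by (rule Lim_null_comparison)
  qed
  \<comment> \<open>If k has the same integral a over all iterates of u, then a minus its integral
    over P u equals its integral over N^(n+1) u for every n: a constant sequence with limit 0. This
    is used for k = 1 and for u = \<mu>0.\<close>
  have P_eq: "?I (P u) k = a"
    if u: "u \<in> ?S" and k: "k \<in> holder_functions sum_dist \<zeta>"
      and a: "\<And>n. ?I ((?T ^^ n) u) k = a" for u k a
  proof -
    have "?I (P u) k + ?I ((N ^^ Suc n) u) k = a" for n
      using a[of "Suc n"] iter[OF u, of "Suc n"] holder(1)[OF k] by (simp add: signed_integral_add)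
    then have "(\<lambda>n. ?I ((N ^^ Suc n) u) k) = (\<lambda>n. a - ?I (P u) k)"
      by (simp add: fun_eq_iff algebra_simps)
    then have "a - ?I (P u) k = 0"
      using LIMSEQ_Suc[OF N_lim[OF u k]] by (simp add: LIMSEQ_const_iff)
    then show ?thesis by simp
  qed
  have one: "(\<lambda>_. 1) \<in> holder_functions sum_dist \<zeta>"
    by (simp add: holder_functions_def holder_const_def bot_ennreal SUP_constant)
  have P_mass: "?I (P u) (\<lambda>_. 1) = ?I u (\<lambda>_. 1)" if "u \<in> ?S" for u
    using that one by (rule P_eq) (simp add: signed_integral_push_forward_funpow[OF _ F_meas])
  have P_\<mu>0: "?I (P (signed_of \<mu>0)) k = (LINT x|\<mu>0. k x)" if k: "k \<in> holder_functions sum_dist \<zeta>" for k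
  proof (rule P_eq[OF mu0(2) k])
    have "(?T ^^ n) (signed_of \<mu>0) = signed_of \<mu>0" for n
      by (induction n) (simp_all add: push_forward_invariant[OF mu0(1) F_meas])
    then show "?I ((?T ^^ n) (signed_of \<mu>0)) k = (LINT x|\<mu>0. k x)" for n
      by (simp add: signed_integral_signed_of holder(1)[OF k] \<mu>0_fin \<mu>0(2))
  qed
  let ?w = "weighted h \<mu>0"
  have w: "?w \<in> ?S" and h_int: "integrable \<mu>0 h"
    using h by (simp_all add: Theta_def)
  \<comment> \<open>The spanning vector is P \<mu>0 rather than \<mu>0, since it visibly lies in the
    range of P and has mass 1.\<close>
  have "P ?w = ?I (P ?w) (\<lambda>_. 1) *\<^sub>R P (signed_of \<mu>0)"
  proof (rule rank_one_eq[OF P_dim, where l = "\<lambda>u. ?I u (\<lambda>_. 1)"])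
    show "?I (P (signed_of \<mu>0)) (\<lambda>_. 1) = 1"
      using P_\<mu>0[OF one] prob_space.prob_space[OF \<mu>0(1)] by simp
  qed (use w mu0(2) in \<open>auto simp: signed_integral_scaleR\<close>)
  moreover have "?I (P ?w) (\<lambda>_. 1) = (LINT p|\<mu>0. h p)"
    using P_mass[OF w] signed_integral_weighted[OF _ \<mu>0(2) h_int, of "\<lambda>_. 1"] by simp
  ultimately have "?I (P ?w) g = (LINT p|\<mu>0. h p) * ?I (P (signed_of \<mu>0)) g"
    using holder(1)[OF g] by (metis signed_integral_scaleR)
  then have Pg: "?I (P ?w) g = (LINT p|\<mu>0. g p) * (LINT p|\<mu>0. h p)"
    by (simp add: P_\<mu>0[OF g])
  \<comment> \<open>G is only assumed Borel, so g composed with F^n need not be Hoelder; bounded and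
    Borel is enough to move F^n from the function to the measure.\<close>
  have "bounded_borel (\<lambda>p. g ((F ^^ n) p))"
    by (rule bounded_borel_compose[OF holder(1)[OF g] measurable_funpow_borel[OF F_meas]])
  then have "(LINT p|\<mu>0. g ((F ^^ n) p) * h p) = ?I ((?T ^^ n) ?w) g"
    using holder(1)[OF g]
    by (simp add: signed_integral_push_forward_funpow F_meas signed_integral_weighted \<mu>0(2) h_int)
  also have "\<dots> = ?I (P ?w) g + ?I ((N ^^ n) ?w) g"
    using holder(1)[OF g] by (simp add: iter[OF w n] signed_integral_add)
  finally have "(LINT p|\<mu>0. g ((F ^^ n) p) * h p) - (LINT p|\<mu>0. g p) * (LINT p|\<mu>0. h p) =
      ?I ((N ^^ n) ?w) g"
    by (simp add: Pg)
  then show ?thesis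
    using N_le[OF w g n] by simp
qed

end
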